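(* Let $y = \mu + u$ with $\mu\in\mathbb{R}^n$, $u\sim N(0,\sigma^2 I_n)$, $\sigma>0$, let $X=(X_1,X_2)$ be a fixed $n\times 2$ matrix of rank $2$, and let $M_1=\{1\}$, $M_2=\{1,2\}$. Let the variance estimator $\hat\sigma^2$, the least-squares quantities $\hat\beta_{j\cdot M}$, $\beta_{j\cdot M}$, $\hat\sigma_{j\cdot M}$, the correlation coefficient $\rho$, and the function $\Delta$ be as defined in the context. Let $C>0$ and $K>0$ be constants, and let $\hat M=M_2$ if $|\hat\beta_{2\cdot M_2}|/\hat\sigma_{2\cdot M_2}>C$ and $\hat M=M_1$ otherwise. Put $\zeta=\beta_{2\cdot M_2}/\operatorname{SD}(\hat\beta_{2\cdot M_2})$, where $\operatorname{SD}(\cdot)$ denotes the standard deviation. Then, for all $\mu\in\mathbb{R}^n$ and $\sigma>0$, $$\mathbb{P}_{\mu,\sigma}\bigl(\beta_{1\cdot\hat M}\in\hat\beta_{1\cdot\hat M}\pm K\hat\sigma_{1\cdot\hat M}\bigr) =\mathbb{E}\left[\Delta\Bigl(0,\tfrac{\hat\sigma}{\sigma}K\Bigr)\,\Delta\Bigl(\zeta,\tfrac{\hat\sigma}{\sigma}C\Bigr) +\int_{-\frac{\hat\sigma}{\sigma}K}^{\frac{\hat\sigma}{\sigma}K}\left(1-\Delta\left(\frac{\zeta+\rho z}{\sqrt{1-\rho^2}},\frac{\frac{\hat\sigma}{\sigma}C}{\sqrt{1-\rho^2}}\right)\right)\phi(z)\,dz\right]$$ and $$\mathbb{P}_{\mu,\sigma}\bigl(\beta_{1\cdot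 M_2}\in\hat\beta_{1\cdot\hat M}\pm K\hat\sigma_{1\cdot\hat M}\bigr) =\mathbb{P}_{\mu,\sigma}\bigl(\beta_{1\cdot\hat M}\in\hat\beta_{1\cdot\hat M}\pm K\hat\sigma_{1\cdot\hat M}\bigr) +\mathbb{E}\left[\left(\Delta\Bigl(\frac{\rho\zeta}{\sqrt{1-\rho^2}},\tfrac{\hat\sigma}{\sigma}K\Bigr)-\Delta\Bigl(0,\tfrac{\hat\sigma}{\sigma}K\Bigr)\right)\Delta\Bigl(\zeta,\tfrac{\hat\sigma}{\sigma}C\Bigr)\right].$$ The expectations on the right-hand sides are taken with respect to $\hat\sigma/\sigma$. In the known-variance case, $\hat\sigma/\sigma$ is constant equal to one (and the expectations are trivial); in the unknown-variance case, $\hat\sigma/\sigma$ is distributed like the square root of a chi-squared random variable with $r$ degrees of freedom divided by $r$, i.e. $\hat\sigma/\sigma\sim\sqrt{\chi^2_r/r}$.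
   Context: For $M\in\{M_1,M_2\}$, $X_M$ is the matrix of those columns of $X$ whose indices lie in $M$. Define $\beta_M=(X_M'X_M)^{-1}X_M'\mu$ and $\hat\beta_M=(X_M'X_M)^{-1}X_M'y$ (prime denotes transpose). For $j\in M$, $\beta_{j\cdot M}$ and $\hat\beta_{j\cdot M}$ denote the components of $\beta_M$ and $\hat\beta_M$ that correspond to the regressor $X_j$. The models need not be correct, i.e. $\mu$ need not lie in the column space of $X$. Variance estimator: $\hat\sigma^2$ ($\hat\sigma\geq 0$) is independent of the collection $\{\hat\beta_{M_1},\hat\beta_{M_2}\}$. Either (unknown-variance case) $\hat\sigma^2\sim\sigma^2\chi^2_r/r$ for some integer $r\ge 1$, or (known-variance case) $\hat\sigma^2=\sigma^2$ (with the convention $r=\infty$). The result covers both cases. $\mathbb{P}_{\mu,\sigma}$ denotes the joint distribution of $y$ and $\hat\sigma$. For $j\in M$, $\hat\sigma_{j\cdot M}\ge 0$ is defined by $\hat\sigma_{j\cdot M}^2=\hat\sigma^2\,d_{j\cdot M}$, where $d_{j\cdot M}$ is the diagonal element of $(X_M'X_M)^{-1}$ corresponding to the regressor $X_j$. The notation $a\pm b$ means the interval $[a-b,a+b]$. $\phi$ and $\Phi$ are the density and cumulative distribution function of the univariate standard Gaussian distribution, and $\Delta(x,c)=\Phi(x+c)-\Phi(x-c)$. The number $\rho$ is the correlation coefficient between the two components of $\hat\beta_{M_2}$, i.e. $\rho=[(X_{M_2}'X_{M_2})^{-1}]_{1,2}\bigl([(X_{M_2}'X_{M_2})^{-1}]_{1,1}[(X_{M_2}'X_{M_2})^{-1}]_{2,2}\bigr)^{-1/2}$.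 *)

theory Defs
  imports "HOL-Probability.Probability"
begin

definition mvnormal_density :: "real^'n \<Rightarrow> real^'n^'n \<Rightarrow> real^'n \<Rightarrow> real" where
  "mvnormal_density m S x =
     exp (- ((x - m) \<bullet> (matrix_inv S *v (x - m))) / 2) / sqrt ((2 * pi) ^ CARD('n) * det S)"

definition chi_square_density :: "nat \<Rightarrow> real \<Rightarrow> real" where
  "chi_square_density r x =
     (if x > 0
      then x powr (real r / 2 - 1) * exp (- x / 2) / (2 powr (real r / 2) * Gamma (real r / 2))
      else 0)"

definition chi_square :: "nat \<Rightarrow> real measure" where
  "chi_square r = density lborel (\<lambda>x. ennreal (chi_square_density r x))"

definition Delta :: "real \<Rightarrow> real \<Rightarrow> real" where
  "Delta x c = cdf std_normal_distribution (x + c) - cdf std_normal_distribution (x - c)"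

definition SD :: "'a measure \<Rightarrow> ('a \<Rightarrow> real) \<Rightarrow> real" where
  "SD P Y = sqrt (\<integral>\<omega>. (Y \<omega> - (\<integral>\<omega>'. Y \<omega>' \<partial>P))\<^sup>2 \<partial>P)"

text \<open>The library's \<open>indep_var\<close> forces both random variables to have the same type; this is its
  characterisation \<open>indep_var_eq\<close> without that restriction.\<close>

definition indep_rv ::
  "'a measure \<Rightarrow> 'b measure \<Rightarrow> ('a \<Rightarrow> 'b) \<Rightarrow> 'c measure \<Rightarrow> ('a \<Rightarrow> 'c) \<Rightarrow> bool" where
  "indep_rv P S Y T Z \<longleftrightarrow>
     Y \<in> measurable P S \<and> Z \<in> measurable P T \<and>
     prob_space.indep_set P
       (sigma_sets (space P) {Y -` A \<inter> space P | A. A \<in> sets S})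
       (sigma_sets (space P) {Z -` A \<inter> space P | A. A \<in> sets T})"

definition pm_interval :: "real \<Rightarrow> real \<Rightarrow> real set" where
  "pm_interval a b = {a - b .. a + b}"

definition inv_gram :: "real^'k^'n \<Rightarrow> real^'k^'k" where
  "inv_gram Z = matrix_inv (transpose Z ** Z)"

definition ols :: "real^'k^'n \<Rightarrow> real^'n \<Rightarrow> real^'k" where
  "ols Z v = (inv_gram Z ** transpose Z) *v v"

text \<open>\<open>M1\<close> and \<open>M2\<close> stand for the index sets \<open>{1}\<close> and \<open>{1, 2}\<close>.
  The design matrix of \<open>M2\<close> is \<open>X\<close> itself. In the index type \<open>2\<close>, the numeral \<open>2\<close> denotes
  the same element as \<open>0\<close>, which is distinct from \<open>1\<close>.\<close>

datatype model = M1 | M2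

definition X_M1 :: "real^2^'n \<Rightarrow> real^1^'n" where
  "X_M1 X = (\<chi> i k. X $ i $ 1)"

text \<open>\<open>coef X M j v\<close> is the component of \<open>ols X\<^sub>M v\<close> belonging to the \<open>j\<close>-th regressor: it is
  \<open>\<beta>\<close> for \<open>v = \<mu>\<close> and its least-squares estimator for \<open>v = y\<close>. Likewise \<open>dcoef X M j\<close> is the
  diagonal entry of the inverse Gram matrix. Both are meaningful only for \<open>j \<in> M\<close>; the values
  at \<open>M = M1\<close>, \<open>j = 2\<close> are junk.\<close>

fun coef :: "real^2^'n \<Rightarrow> model \<Rightarrow> 2 \<Rightarrow> real^'n \<Rightarrow> real" where
  "coef X M1 j v = ols (X_M1 X) v $ 1"
| "coef X M2 j v = ols X v $ j"

fun dcoef :: "real^2^'n \<Rightarrow> model \<Rightarrow> 2 \<Rightarrow> real" where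
  "dcoef X M1 j = inv_gram (X_M1 X) $ 1 $ 1"
| "dcoef X M2 j = inv_gram X $ j $ j"

definition se :: "real^2^'n \<Rightarrow> model \<Rightarrow> 2 \<Rightarrow> real \<Rightarrow> real" where
  "se X M j s = sqrt (s\<^sup>2 * dcoef X M j)"

definition rho :: "real^2^'n \<Rightarrow> real" where
  "rho X = inv_gram X $ 1 $ 2 * (inv_gram X $ 1 $ 1 * inv_gram X $ 2 $ 2) powr (- 1 / 2)"

definition selected :: "real^2^'n \<Rightarrow> real \<Rightarrow> real^'n \<Rightarrow> real \<Rightarrow> model" where
  "selected X C y s = (if \<bar>coef X M2 2 y\<bar> / se X M2 2 s > C then M2 else M1)"

text \<open>\<open>r = \<infinity>\<close> encodes the known-variance case.\<close>

definition variance_estimator ::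
  "'a measure \<Rightarrow> enat \<Rightarrow> real \<Rightarrow> ('a \<Rightarrow> real) \<Rightarrow> bool" where
  "variance_estimator P r \<sigma> s \<longleftrightarrow>
     (case r of
        enat k \<Rightarrow> k \<ge> 1 \<and>
          distr P borel (\<lambda>\<omega>. (s \<omega>)\<^sup>2) = distr (chi_square k) borel (\<lambda>x. \<sigma>\<^sup>2 * x / real k)
      | \<infinity> \<Rightarrow> (\<forall>\<omega>\<in>space P. (s \<omega>)\<^sup>2 = \<sigma>\<^sup>2))"

end

theory Submission
  imports Defs
begin

text \<open>Let \<open>p\<close> be the normalised first regressor, \<open>- q\<close> the normalised residual of the second one, and
  \<open>Z\<^sub>1 = p \<bullet> u / \<sigma>\<close>, \<open>Z\<^sub>2 = q \<bullet> u / \<sigma>\<close>, \<open>S = s / \<sigma>\<close>. By rotation invariance \<open>Z\<^sub>1\<close> and \<open>Z\<^sub>2\<close> are independent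
  standard normal variables, and they are independent of \<open>S\<close>. The large model is selected iff
  \<open>|\<zeta> - Z\<^sub>2| > S C\<close>. The interval of the small model covers its own target iff \<open>|Z\<^sub>1| \<le> S K\<close> and the
  target of the large model iff \<open>|\<rho> \<zeta> / r - Z\<^sub>1| \<le> S K\<close>, where \<open>r\<^sup>2 = 1 - \<rho>\<^sup>2\<close>; in both cases the
  conditional probability given \<open>S\<close> is a product. The interval of the large model covers its target
  iff \<open>|Z| \<le> S K\<close> for the rotated pair \<open>Z = r Z\<^sub>1 - \<rho> Z\<^sub>2\<close>, \<open>W = \<rho> Z\<^sub>1 + r Z\<^sub>2\<close>. Since
  \<open>Z\<^sub>2 = r W - \<rho> Z\<close>, integrating first over \<open>W\<close> gives the integral term.\<close>

subsection \<open>Orthogonal invariance of Lebesgue measure\<close>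

lemma nn_integral_lborel_translate:
  fixes f :: "'a::euclidean_space \<Rightarrow> ennreal"
  assumes [measurable]: "f \<in> borel_measurable borel"
  shows "(\<integral>\<^sup>+x. f (x + c) \<partial>lborel) = (\<integral>\<^sup>+x. f x \<partial>lborel)"
proof -
  have "(\<integral>\<^sup>+x. f x \<partial>lborel) = (\<integral>\<^sup>+x. f x \<partial>distr lborel borel ((+) c))"
    by (simp only: lborel_distr_plus)
  then show ?thesis
    by (simp add: nn_integral_distr add.commute)
qed

lemma nn_integral_lborel_reflect:
  fixes f :: "'a::euclidean_space \<Rightarrow> ennreal"
  assumes [measurable]: "f \<in> borel_measurable borel"
  shows "(\<integral>\<^sup>+x. f (c - x) \<partial>lborel) = (\<integral>\<^sup>+x. f x \<partial>lborel)"
proof -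
  have "lborel = distr lborel borel (\<lambda>x::'a. c - x)"
    using lborel_affine[of "-1" c] by (simp add: density_1)
  then have "(\<integral>\<^sup>+x. f x \<partial>lborel) = (\<integral>\<^sup>+x. f x \<partial>distr lborel borel (\<lambda>x. c - x))"
    by simp
  then show ?thesis
    by (simp add: nn_integral_distr)
qed

text \<open>Uniqueness of Haar measure by Fubini: the image of Lebesgue measure under \<open>T\<close> is
  translation invariant, hence proportional to Lebesgue measure.\<close>

lemma emeasure_lborel_orthogonal_vimage_commute:
  fixes T :: "'a::euclidean_space \<Rightarrow> 'a"
  assumes T: "orthogonal_transformation T"
    and A[measurable]: "A \<in> sets borel" and B[measurable]: "B \<in> sets borel"
  shows "emeasure lborel (T -` A) * emeasure lborel B = emeasure lborel A * emeasure lborel (T -` B)"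
proof -
  have lin: "linear T"
    using T by (rule orthogonal_transformation_linear)
  have [measurable]: "T \<in> borel_measurable borel"
    using lin by (intro borel_measurable_continuous_onI linear_continuous_on)
      (simp add: linear_conv_bounded_linear)
  \<comment> \<open>\<open>T'\<close> is a right inverse of \<open>T\<close>; it turns a shift of
    \<open>T x\<close> into a shift of \<open>x\<close>.\<close>
  obtain T' where T': "\<And>y. T (T' y) = y"
    using orthogonal_transformation_surj[OF T] by (metis surj_def)
  have [measurable]: "T -` A \<in> sets borel" "T -` B \<in> sets borel"
    using measurable_sets_borel[of T borel] by auto
  have swap: "(\<integral>\<^sup>+x. \<integral>\<^sup>+y. f x y \<partial>lborel \<partial>lborel) = (\<integral>\<^sup>+y. \<integral>\<^sup>+x. f x y \<partial>lborel \<partial>lborel)"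
    if "(\<lambda>(x, y). f x y) \<in> borel_measurable (lborel \<Otimes>\<^sub>M lborel)" for f :: "'a \<Rightarrow> 'a \<Rightarrow> ennreal"
    using lborel_pair.Fubini'[OF that] by simp
  have vimage: "(\<integral>\<^sup>+x. indicator C (T x) \<partial>lborel) = emeasure lborel (T -` C)"
    if "T -` C \<in> sets borel" for C
    using nn_integral_indicator[of "T -` C" lborel] that
    by (simp add: indicator_vimage[symmetric] del: nn_integral_indicator)
  have "emeasure lborel (T -` A) * emeasure lborel B
      = (\<integral>\<^sup>+x. indicator A (T x) * emeasure lborel B \<partial>lborel)"
    by (simp add: nn_integral_multc vimage)
  \<comment> \<open>For fixed \<open>x\<close>, translating \<open>y\<close> by \<open>T x\<close>
    does not change the mass of \<open>B\<close>. This couples the two variables.\<close>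
  also have "\<dots> = (\<integral>\<^sup>+x. \<integral>\<^sup>+y. indicator A (T x) * indicator B (y + T x) \<partial>lborel \<partial>lborel)"
    by (simp add: nn_integral_cmult nn_integral_lborel_translate)
  also have "\<dots> = (\<integral>\<^sup>+y. \<integral>\<^sup>+x. indicator A (T x) * indicator B (y + T x) \<partial>lborel \<partial>lborel)"
    by (rule swap) measurable
  \<comment> \<open>For fixed \<open>y\<close>, shifting \<open>x\<close> by \<open>T' (- y)\<close>
    replaces \<open>T x\<close> by \<open>T x - y\<close>, so the dependence on \<open>y\<close>
    moves from \<open>B\<close> to \<open>A\<close>.\<close>
  also have "\<dots> = (\<integral>\<^sup>+y. \<integral>\<^sup>+x. indicator A (T x - y) * indicator B (T x) \<partial>lborel \<partial>lborel)"
  proof (rule nn_integral_cong)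
    fix y :: 'a
    have "T (x + T' (- y)) = T x - y" for x
      using lin by (simp add: linear_add T')
    then show "(\<integral>\<^sup>+x. indicator A (T x) * indicator B (y + T x) \<partial>lborel)
        = (\<integral>\<^sup>+x. indicator A (T x - y) * indicator B (T x) \<partial>lborel)"
      using nn_integral_lborel_translate[of "\<lambda>x. indicator A (T x) * indicator B (y + T x)" "T' (- y)"]
      by simp
  qed
  also have "\<dots> = (\<integral>\<^sup>+x. \<integral>\<^sup>+y. indicator A (T x - y) * indicator B (T x) \<partial>lborel \<partial>lborel)"
    by (rule swap[symmetric]) measurable
  \<comment> \<open>The inner integral is that of \<open>indicator A\<close> along the reflected
    variable \<open>T x - y\<close>.\<close>
  also have "\<dots> = (\<integral>\<^sup>+x. emeasure lborel A * indicator B (T x) \<partial>lborel)"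
    by (simp add: nn_integral_multc nn_integral_lborel_reflect)
  also have "\<dots> = emeasure lborel A * emeasure lborel (T -` B)"
    by (simp add: nn_integral_cmult vimage)
  finally show ?thesis .
qed

text \<open>Take \<open>B\<close> to be the unit ball in the commutation identity: \<open>T\<close>
  preserves norms, so the ball is its own preimage, and its measure cancels because it is positive
  and finite.\<close>

lemma distr_lborel_orthogonal_transformation:
  fixes T :: "'a::euclidean_space \<Rightarrow> 'a"
  assumes T: "orthogonal_transformation T"
  shows "distr lborel borel T = lborel"
proof (rule measure_eqI)
  fix A assume "A \<in> sets (distr lborel borel T)"
  then have A: "A \<in> sets borel"
    by simp
  have meas: "T \<in> borel_measurable borel"
    using T by (intro borel_measurable_continuous_onI linear_continuous_on)
      (simp add: linear_conv_bounded_linear[symmetric] orthogonal_transformation_linear)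
  let ?b = "emeasure lborel (ball (0::'a) 1)"
  have "T -` ball 0 1 = ball 0 1"
    using T by (auto simp: orthogonal_transformation)
  then have "emeasure lborel (T -` A) * ?b = emeasure lborel A * ?b"
    using emeasure_lborel_orthogonal_vimage_commute[OF T A, of "ball 0 1"] by simp
  moreover have "?b \<noteq> 0" "?b \<noteq> \<infinity>"
    using emeasure_lborel_ball_finite[of "0::'a" 1] content_ball_pos[of 1 "0::'a"]
    by (auto simp: measure_def)
  ultimately have "emeasure lborel (T -` A) = emeasure lborel A"
    by (metis ennreal_mult_cancel_left mult.commute infinity_ennreal_def)
  then show "emeasure (distr lborel borel T) A = emeasure lborel A"
    using A meas by (simp add: emeasure_distr)
qed simp

text \<open>For \<open>h = 0\<close> this is the identity, since \<open>x / 0 = 0\<close>.\<close>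

definition reflect :: "'a::euclidean_space \<Rightarrow> 'a \<Rightarrow> 'a" where
  "reflect h x = x - (2 * (x \<bullet> h) / (h \<bullet> h)) *\<^sub>R h"

lemma orthogonal_transformation_reflect: "orthogonal_transformation (reflect h)"
proof (cases "h = 0")
  case True
  then have "reflect h = (\<lambda>x. x)"
    by (auto simp: reflect_def)
  then show ?thesis
    by simp
next
  case False
  have "linear (reflect h)"
    by (rule linearI) (simp_all add: reflect_def inner_simps algebra_simps add_divide_distrib)
  moreover have "reflect h x \<bullet> reflect h y = x \<bullet> y" for x y
    using False by (simp add: reflect_def inner_simps inner_commute field_simps)
  ultimately show ?thesis
    by (simp add: orthogonal_transformation_def)
qed

lemma reflect_reflect: "reflect h (reflect h x) = x"
  by (cases "h = 0") (simp_all add: reflect_def inner_simps algebra_simps flip: scaleR_add_left)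

text \<open>Householder reflection: equal lengths give 2 (a . (a - b)) = |a - b|^2, so the
  coefficient in \<open>reflect\<close> is 1 and a - (a - b) = b.\<close>

lemma reflect_diff:
  assumes "a \<bullet> a = b \<bullet> b"
  shows "reflect (a - b) a = b"
proof (cases "a = b")
  case True
  then show ?thesis
    by (simp add: reflect_def)
next
  case False
  then have "(a - b) \<bullet> (a - b) \<noteq> 0"
    by simp
  moreover have "2 * (a \<bullet> (a - b)) = (a - b) \<bullet> (a - b)"
    using assms by (simp add: inner_simps inner_commute)
  ultimately show ?thesis
    by (simp add: reflect_def)
qed

text \<open>Two reflections suffice: \<open>R1\<close> exchanges \<open>a\<close> and
  \<open>p\<close>; \<open>R2\<close> sends \<open>b\<close> to \<open>R1 q\<close> while fixing
  \<open>a\<close>. Then \<open>R1 \<circ> R2\<close> does both jobs, since \<open>R1\<close> is an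
  involution.\<close>

lemma orthogonal_transformation_exists_2:
  fixes a b p q :: "'a::euclidean_space"
  assumes "p \<bullet> p = a \<bullet> a" "q \<bullet> q = b \<bullet> b" "p \<bullet> q = 0" "a \<bullet> b = 0"
  obtains T where "orthogonal_transformation T" "T a = p" "T b = q"
proof -
  define R1 where "R1 = reflect (a - p)"
  define R2 where "R2 = reflect (b - R1 q)"
  have o1: "orthogonal_transformation R1"
    by (simp add: R1_def orthogonal_transformation_reflect)
  have R1a: "R1 a = p"
    using assms by (simp add: R1_def reflect_diff)
  then have R1p: "R1 p = a"
    unfolding R1_def using reflect_reflect by metis
  \<comment> \<open>\<open>a = R1 p\<close> and \<open>R1\<close> preserves inner products, so this
    is \<open>p \<bullet> q\<close>. Hence \<open>a\<close> is orthogonal to the normal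
    \<open>b - R1 q\<close> of \<open>R2\<close>.\<close>
  have "a \<bullet> R1 q = 0"
    using o1 R1p assms unfolding orthogonal_transformation_def by metis
  then have "R2 a = a"
    using assms by (simp add: R2_def reflect_def inner_simps)
  moreover have "R1 q \<bullet> R1 q = b \<bullet> b"
    using o1 assms by (simp add: orthogonal_transformation_def)
  then have "R2 b = R1 q"
    by (simp add: R2_def reflect_diff)
  moreover have "R1 (R1 q) = q"
    by (simp add: R1_def reflect_reflect)
  ultimately show thesis
    using o1 R1a
    by (intro that[of "R1 \<circ> R2"])
      (auto simp: R2_def intro!: orthogonal_transformation_compose orthogonal_transformation_reflect)
qed

subsection \<open>The isotropic normal distribution\<close>

lemma det_scaleR_mat_1: "det (c *\<^sub>R mat 1 :: real^'n^'n) = c ^ CARD('n)"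
  by (subst det_diagonal) (simp_all add: mat_def)

text \<open>\<open>matrix_inv\<close> is defined by choice. A one-sided inverse of a square matrix
  is two-sided, so the choice has a witness, and uniqueness of inverses identifies it.\<close>

lemma matrix_inv_eq:
  fixes A B :: "real^'k^'k"
  assumes "A ** B = mat 1"
  shows "matrix_inv A = B"
proof -
  have BA: "B ** A = mat 1"
    using assms by (simp add: matrix_left_right_inverse)
  then have "A ** matrix_inv A = mat 1"
    unfolding matrix_inv_def using assms by (metis (mono_tags, lifting) someI_ex)
  then have "B ** (A ** matrix_inv A) = B"
    by simp
  then show ?thesis
    using BA by (simp add: matrix_mul_assoc)
qed

lemma mvnormal_density_isotropic:
  fixes x :: "real^'n"
  assumes "\<sigma> > 0"
  shows "mvnormal_density 0 (\<sigma>\<^sup>2 *\<^sub>R mat 1) x =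
    exp (- (x \<bullet> x) / (2 * \<sigma>\<^sup>2)) / sqrt (2 * pi * \<sigma>\<^sup>2) ^ CARD('n)"
proof -
  have "matrix_inv (\<sigma>\<^sup>2 *\<^sub>R mat 1 :: real^'n^'n) = (1 / \<sigma>\<^sup>2) *\<^sub>R mat 1"
    using assms by (intro matrix_inv_eq)
      (simp add: matrix_eq matrix_vector_mult_scaleR
        flip: matrix_vector_mul_assoc scaleR_matrix_vector_assoc)
  moreover have "(2 * pi) ^ CARD('n) * (\<sigma>\<^sup>2) ^ CARD('n) = (2 * pi * \<sigma>\<^sup>2) ^ CARD('n)"
    by (simp only: power_mult_distrib)
  ultimately show ?thesis
    by (simp add: mvnormal_density_def det_scaleR_mat_1 real_sqrt_power mult.commute
        flip: scaleR_matrix_vector_assoc)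
qed

text \<open>The squared norm is the sum of the squared coordinates. The product form is what lets
  integrals split over the axes.\<close>

lemma mvnormal_density_isotropic_prod:
  fixes x :: "real^'n"
  assumes "\<sigma> > 0"
  shows "mvnormal_density 0 (\<sigma>\<^sup>2 *\<^sub>R mat 1) x = (\<Prod>b\<in>Basis. normal_density 0 \<sigma> (x \<bullet> b))"
proof -
  have "(\<Prod>b\<in>Basis. normal_density 0 \<sigma> (x \<bullet> b))
      = (\<Prod>b::real^'n\<in>Basis. exp (- (x \<bullet> b)\<^sup>2 / (2 * \<sigma>\<^sup>2)) / sqrt (2 * pi * \<sigma>\<^sup>2))"
    by (simp add: normal_density_def)
  also have "\<dots> = exp (\<Sum>b::real^'n\<in>Basis. - (x \<bullet> b)\<^sup>2 / (2 * \<sigma>\<^sup>2)) / sqrt (2 * pi * \<sigma>\<^sup>2) ^ CARD('n)"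
    by (simp add: prod_dividef exp_sum)
  also have "(\<Sum>b::real^'n\<in>Basis. - (x \<bullet> b)\<^sup>2 / (2 * \<sigma>\<^sup>2)) = - (x \<bullet> x) / (2 * \<sigma>\<^sup>2)"
    by (simp add: euclidean_inner[of x x] sum_divide_distrib sum_negf power2_eq_square)
  finally show ?thesis
    using mvnormal_density_isotropic[OF assms, of x] by simp
qed

text \<open>Substitute \<sigma> x for x: the Jacobian cancels the factor \<sigma> in the normalising
  constant.\<close>

lemma nn_integral_normal_density_scaled:
  assumes "\<sigma> > 0" and [measurable]: "A \<in> sets borel"
  shows "(\<integral>\<^sup>+x. ennreal (normal_density 0 \<sigma> x) * indicator A (x / \<sigma>) \<partial>lborel)
    = emeasure std_normal_distribution A"
proof -
  have "(\<integral>\<^sup>+x. ennreal (normal_density 0 \<sigma> x) * indicator A (x / \<sigma>) \<partial>lborel)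
      = (\<integral>\<^sup>+x. ennreal \<sigma> * (ennreal (normal_density 0 \<sigma> (\<sigma> * x)) * indicator A x) \<partial>lborel)"
    using assms(1) by (subst nn_integral_real_affine[where c=\<sigma> and t=0])
      (simp_all add: nn_integral_cmult)
  also have "\<dots> = (\<integral>\<^sup>+x. ennreal (std_normal_density x) * indicator A x \<partial>lborel)"
  proof (rule nn_integral_cong)
    fix x
    have "\<sigma> * normal_density 0 \<sigma> (\<sigma> * x) = std_normal_density x"
      using assms(1) by (simp add: normal_density_def real_sqrt_mult power_mult_distrib)
    then show "ennreal \<sigma> * (ennreal (normal_density 0 \<sigma> (\<sigma> * x)) * indicator A x)
        = ennreal (std_normal_density x) * indicator A x"
      using assms(1) by (simp add: mult.assoc[symmetric] flip: ennreal_mult)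
  qed
  finally show ?thesis
    by (simp add: emeasure_density)
qed

lemma prob_space_std_normal: "prob_space std_normal_distribution"
  using prob_space_normal_density[of 1 0] by simp

text \<open>It suffices to compare rectangles. An orthogonal map taking two coordinate axes to
  \<open>p\<close> and \<open>q\<close> preserves Lebesgue measure and the density, so both
  projections may be replaced by coordinates, where the density factorises.\<close>

lemma (in prob_space) distr_orthonormal_normal:
  fixes u :: "'a \<Rightarrow> real^'n" and p q :: "real^'n"
  assumes "\<sigma> > 0"
    and u: "distributed M lborel u (mvnormal_density 0 (\<sigma>\<^sup>2 *\<^sub>R mat 1))"
    and pq: "p \<bullet> p = 1" "q \<bullet> q = 1" "p \<bullet> q = 0"
  shows "distr M (borel \<Otimes>\<^sub>M borel) (\<lambda>\<omega>. (p \<bullet> u \<omega> / \<sigma>, q \<bullet> u \<omega> / \<sigma>))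
    = std_normal_distribution \<Otimes>\<^sub>M std_normal_distribution" (is "?D = ?N \<Otimes>\<^sub>M ?N")
proof (rule pair_measure_eqI[symmetric])
  interpret N: prob_space ?N
    by (rule prob_space_std_normal)
  show "sigma_finite_measure ?N" "sigma_finite_measure ?N"
    by unfold_locales
  show "sets (?N \<Otimes>\<^sub>M ?N) = sets ?D"
    by (simp cong: sets_pair_measure_cong)
  fix A B assume "A \<in> sets ?N" "B \<in> sets ?N"
  then have A[measurable]: "A \<in> sets borel" and B[measurable]: "B \<in> sets borel"
    by simp_all
  let ?f = "mvnormal_density 0 (\<sigma>\<^sup>2 *\<^sub>R mat 1) :: real^'n \<Rightarrow> real"
  have u_meas[measurable]: "u \<in> borel_measurable M" and f_meas[measurable]: "?f \<in> borel_measurable borel"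
    and D: "distr M lborel u = density lborel ?f"
    using u distributed_measurable[OF u]
    by (auto simp: distributed_def mvnormal_density_isotropic[OF assms(1), abs_def])
  \<comment> \<open>Two orthonormal vectors do not fit into dimension one, so the index type has two
    distinct elements.\<close>
  obtain i j :: 'n where "i \<noteq> j"
  proof -
    have "\<exists>i j :: 'n. i \<noteq> j"
    proof (rule ccontr)
      assume "\<not> (\<exists>i j :: 'n. i \<noteq> j)"
      then obtain i :: 'n where UN: "(UNIV :: 'n set) = {i}"
        by blast
      have "p $ i * q $ i = 0" "p $ i * p $ i = 1" "q $ i * q $ i = 1"
        using pq by (simp_all add: inner_vec_def UN)
      then show False
        by auto
    qed
    then show thesis
      using that by blast
  qed
  define a b :: "real^'n" where "a = axis i 1" and "b = axis j 1"
  have Basis: "a \<in> Basis" "b \<in> Basis" "a \<noteq> b"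
    using \<open>i \<noteq> j\<close> by (auto simp: a_def b_def axis_eq_axis Basis_vec_def)
  then have "a \<bullet> a = 1" "b \<bullet> b = 1" "a \<bullet> b = 0"
    by (simp_all add: inner_Basis)
  then obtain T where T: "orthogonal_transformation T" "T a = p" "T b = q"
    using orthogonal_transformation_exists_2[of p a q b] pq by metis
  have [measurable]: "T \<in> borel_measurable borel"
    using T(1) by (intro borel_measurable_continuous_onI linear_continuous_on)
      (simp add: linear_conv_bounded_linear[symmetric] orthogonal_transformation_linear)
  have TT: "T x \<bullet> T y = x \<bullet> y" for x y
    using T(1) by (simp add: orthogonal_transformation_def)
  then have pT: "p \<bullet> T x = x \<bullet> a" and qT: "q \<bullet> T x = x \<bullet> b" and fT: "?f (T x) = ?f x" for x
    by (simp_all add: mvnormal_density_isotropic[OF assms(1)] inner_commute flip: T(2,3))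
  \<comment> \<open>The factor of the integrand along the axis \<open>c\<close>; only the axes
    \<open>a\<close> and \<open>b\<close> carry a constraint.\<close>
  define g where "g c z = ennreal (normal_density 0 \<sigma> z) *
      (if c = a then indicator A (z / \<sigma>) else if c = b then indicator B (z / \<sigma>) else 1)"
    for c :: "real^'n" and z
  have g_meas: "g c \<in> borel_measurable borel" for c
    unfolding g_def by measurable
  have "emeasure ?D (A \<times> B) = emeasure (distr M lborel u) {x. p \<bullet> x / \<sigma> \<in> A \<and> q \<bullet> x / \<sigma> \<in> B}"
    by (subst (1 2) emeasure_distr) (auto simp: intro!: arg_cong[where f="emeasure M"])
  also have "\<dots> = (\<integral>\<^sup>+x. ennreal (?f x) * (indicator A (p \<bullet> x / \<sigma>) * indicator B (q \<bullet> x / \<sigma>)) \<partial>lborel)"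
    unfolding D by (subst emeasure_density) (auto intro!: nn_integral_cong split: split_indicator)
  also have "\<dots> = (\<integral>\<^sup>+x. ennreal (?f x) * (indicator A (p \<bullet> x / \<sigma>) * indicator B (q \<bullet> x / \<sigma>)) \<partial>distr lborel borel T)"
    by (simp only: distr_lborel_orthogonal_transformation[OF T(1)])
  also have "\<dots> = (\<integral>\<^sup>+x. ennreal (?f x) * (indicator A (x \<bullet> a / \<sigma>) * indicator B (x \<bullet> b / \<sigma>)) \<partial>lborel)"
    by (simp add: nn_integral_distr pT qT fT)
  also have "\<dots> = (\<integral>\<^sup>+x. (\<Prod>c\<in>Basis. g c (x \<bullet> c)) \<partial>lborel)"
  proof (rule nn_integral_cong)
    fix x :: "real^'n"
    have "(\<Prod>c\<in>Basis. if c = a then indicator A (x \<bullet> c / \<sigma>) else if c = b then indicator B (x \<bullet> c / \<sigma>) else (1::ennreal))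
        = (\<Prod>c\<in>{a, b}. if c = a then indicator A (x \<bullet> c / \<sigma>) else if c = b then indicator B (x \<bullet> c / \<sigma>) else 1)"
      using Basis by (intro prod.mono_neutral_right) auto
    also have "\<dots> = indicator A (x \<bullet> a / \<sigma>) * indicator B (x \<bullet> b / \<sigma>)"
      using Basis by simp
    finally show "ennreal (?f x) * (indicator A (x \<bullet> a / \<sigma>) * indicator B (x \<bullet> b / \<sigma>)) = (\<Prod>c\<in>Basis. g c (x \<bullet> c))"
      by (simp add: g_def prod.distrib mvnormal_density_isotropic_prod[OF assms(1)] prod_ennreal)
  qed
  also have "\<dots> = (\<Prod>c\<in>Basis. \<integral>\<^sup>+x. g c x \<partial>lborel)"
    using g_meas by (intro nn_integral_lborel_prod) auto
  also have "\<dots> = (\<Prod>c\<in>{a, b}. \<integral>\<^sup>+x. g c x \<partial>lborel)"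
  \<comment> \<open>Every unconstrained axis contributes the total mass 1.\<close>
  proof (intro prod.mono_neutral_right ballI)
    fix c assume "c \<in> Basis - {a, b}"
    then show "(\<integral>\<^sup>+x. g c x \<partial>lborel) = 1"
      using nn_integral_normal_density_scaled[OF assms(1), of UNIV] N.emeasure_space_1
      by (simp add: g_def)
  qed (use Basis in auto)
  also have "\<dots> = emeasure ?N A * emeasure ?N B"
    using Basis by (simp add: g_def nn_integral_normal_density_scaled[OF assms(1)])
  finally show "emeasure ?N A * emeasure ?N B = emeasure ?D (A \<times> B)"
    by simp
qed

subsection \<open>Least squares with two regressors\<close>

text \<open>The adjugate of the Gram matrix divided by its determinant a c - b^2.\<close>

lemma inv_gram_2:
  fixes X :: "real^2^'n"
  defines "a \<equiv> column 1 X \<bullet> column 1 X" and "b \<equiv> column 1 X \<bullet> column 2 X"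
    and "c \<equiv> column 2 X \<bullet> column 2 X"
  assumes "a * c - b\<^sup>2 \<noteq> 0"
  shows "inv_gram X = (1 / (a * c - b\<^sup>2)) *\<^sub>R (\<chi> i j. if i = j then (if i = 1 then c else a) else - b)"
  unfolding inv_gram_def
proof (rule matrix_inv_eq)
  have b': "column 2 X \<bullet> column 1 X = b"
    by (simp add: b_def inner_commute)
  have "(c * a - b * b) / (a * c - b\<^sup>2) = 1"
    using assms(4) by (simp add: power2_eq_square mult.commute)
  then show "transpose X ** X **
      ((1 / (a * c - b\<^sup>2)) *\<^sub>R (\<chi> i j. if i = j then (if i = 1 then c else a) else - b)) = mat 1"
    unfolding matrix_mult_transpose_dot_column
    by (simp add: vec_eq_iff matrix_matrix_mult_def forall_2 sum_2 mat_def b' diff_divide_distrib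
        mult.commute flip: a_def b_def c_def)
qed

lemma inv_gram_X_M1:
  assumes "column 1 X \<bullet> column 1 X \<noteq> 0"
  shows "inv_gram (X_M1 X) $ 1 $ 1 = 1 / (column 1 X \<bullet> column 1 X)"
proof -
  have [simp]: "column 1 (X_M1 X) = column 1 X"
    by (simp add: X_M1_def column_def)
  then have "inv_gram (X_M1 X) = mat (1 / (column 1 X \<bullet> column 1 X))"
    unfolding inv_gram_def matrix_mult_transpose_dot_column using assms
    by (intro matrix_inv_eq) (simp add: vec_eq_iff matrix_matrix_mult_def mat_def sum_1)
  then show ?thesis
    by (simp add: mat_def)
qed

text \<open>Simplification turns \<open>transpose A *v v\<close> into \<open>v v* A\<close>; this
  reads off its entries.\<close>

lemma vector_matrix_mult_nth: "(v v* A) $ j = column j A \<bullet> v"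
  by (simp add: vector_matrix_mult_def column_def inner_vec_def mult.commute)

text \<open>Here \<open>p = X\<^sub>1 / |X\<^sub>1|\<close>, and \<open>- q\<close> is the normalised residual of \<open>X\<^sub>2\<close> after projection on \<open>X\<^sub>1\<close>.\<close>

lemma orthonormal_coefficients:
  fixes X :: "real^2^'n"
  assumes "rank X = 2"
  obtains p q :: "real^'n" and \<alpha> \<tau> r :: real where
    "p \<bullet> p = 1" "q \<bullet> q = 1" "p \<bullet> q = 0" "\<alpha> > 0" "\<tau> > 0" "r > 0"
    "r\<^sup>2 + (rho X)\<^sup>2 = 1"
    "\<And>v. coef X M1 1 v = \<alpha> * (p \<bullet> v)"
    "\<And>v. coef X M2 2 v = - \<tau> * (q \<bullet> v)"
    "\<And>v. coef X M2 1 v = \<alpha> / r * (r * (p \<bullet> v) - rho X * (q \<bullet> v))"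
    "\<And>s. s \<ge> 0 \<Longrightarrow> se X M1 1 s = \<alpha> * s"
    "\<And>s. s \<ge> 0 \<Longrightarrow> se X M2 2 s = \<tau> * s"
    "\<And>s. s \<ge> 0 \<Longrightarrow> se X M2 1 s = \<alpha> / r * s"
proof -
  define X1 X2 where "X1 = column 1 X" and "X2 = column 2 X"
  define a b c where "a = X1 \<bullet> X1" and "b = X1 \<bullet> X2" and "c = X2 \<bullet> X2"
  define d where "d = a * c - b\<^sup>2"
  have b': "X2 \<bullet> X1 = b"
    by (simp add: b_def inner_commute)
  have inj: "x = 0" if "X *v x = 0" for x
    using that assms full_rank_injective[of X] matrix_left_invertible_ker[of X]
      matrix_left_invertible_injective[of X] by simp
  have Xv: "X *v x = x $ 1 *\<^sub>R X1 + x $ 2 *\<^sub>R X2" for x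
    by (simp add: vec_eq_iff matrix_vector_mult_def X1_def X2_def column_def sum_2 mult.commute)
  have ind: "s = 0 \<and> t = 0" if "s *\<^sub>R X1 + t *\<^sub>R X2 = 0" for s t
    using inj[of "vector [s, t]"] that by (simp add: Xv vec_eq_iff forall_2)
  have "X1 \<noteq> 0" "X2 \<noteq> 0"
    using ind[of 1 0] ind[of 0 1] by auto
  then have "a > 0" "c > 0"
    by (simp_all add: a_def c_def)
  \<comment> \<open>\<open>w\<close> is \<open>- a\<close> times the residual of \<open>X2\<close>
    after projection on \<open>X1\<close>. It is nonzero by independence, so w . w = a d gives d >
    0, the strict Cauchy-Schwarz inequality.\<close>
  define w where "w = b *\<^sub>R X1 - a *\<^sub>R X2"
  have "w \<noteq> 0"
    using ind[of b "- a"] \<open>a > 0\<close> by (auto simp: w_def)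
  moreover have ww: "w \<bullet> w = a * d"
    by (simp add: w_def d_def inner_simps b' power2_eq_square algebra_simps flip: a_def b_def c_def)
  ultimately have "a * d > 0"
    by (metis inner_gt_zero_iff)
  then have "d > 0"
    using \<open>a > 0\<close> by (simp add: zero_less_mult_iff)
  have X1w: "X1 \<bullet> w = 0"
    by (simp add: w_def inner_simps flip: a_def b_def)
  have gram: "inv_gram X $ 1 $ 1 = c / d" "inv_gram X $ 1 $ 2 = - b / d"
      "inv_gram X $ 2 $ 1 = - b / d" "inv_gram X $ 2 $ 2 = a / d"
    using \<open>d > 0\<close> inv_gram_2[of X]
    by (simp_all add: d_def a_def b_def c_def X1_def X2_def)
  have gram1: "inv_gram (X_M1 X) $ 1 $ 1 = 1 / a"
    using inv_gram_X_M1[of X] \<open>a > 0\<close> by (simp add: a_def X1_def)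
  have col1: "column 1 (X_M1 X) = X1"
    by (simp add: X1_def X_M1_def column_def)
  have ols: "ols Z v = inv_gram Z *v (transpose Z *v v)" for Z :: "real^'k^'n" and v
    by (simp add: ols_def flip: matrix_vector_mul_assoc)
  have "(inv_gram X $ 1 $ 1 * inv_gram X $ 2 $ 2) powr (- 1 / 2) = 1 / sqrt (c * a / (d * d))"
    using \<open>a > 0\<close> \<open>c > 0\<close> \<open>d > 0\<close> powr_minus[of "c * a / (d * d)" "1 / 2"]
    by (simp add: gram powr_half_sqrt inverse_eq_divide)
  \<comment> \<open>The determinant \<open>d\<close> cancels: \<rho> is minus the cosine of the
    angle between the regressors.\<close>
  then have rho: "rho X = - b / sqrt (a * c)"
    using \<open>d > 0\<close> by (simp add: rho_def gram real_sqrt_divide mult.commute)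
  define p q where "p = (1 / sqrt a) *\<^sub>R X1" and "q = (1 / sqrt (a * d)) *\<^sub>R w"
  \<comment> \<open>The sine of that angle: d / (a c) = 1 - b^2 / (a c).\<close>
  define r where "r = sqrt (d / (a * c))"
  have sqrt_nz: "sqrt a > 0" "sqrt c > 0" "sqrt d > 0"
    using \<open>a > 0\<close> \<open>c > 0\<close> \<open>d > 0\<close> by simp_all
  have sq: "sqrt a * sqrt a = a" "sqrt c * sqrt c = c" "sqrt d * sqrt d = d"
    using \<open>a > 0\<close> \<open>c > 0\<close> \<open>d > 0\<close> by simp_all
  have ar: "1 / sqrt a / r = sqrt (c / d)"
    using sqrt_nz by (simp add: r_def real_sqrt_mult real_sqrt_divide)
  show thesis
  \<comment> \<open>1 / sqrt a and sqrt (a / d) are the roots of the diagonal entries of the inverse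
    Gram matrices, that is, standard deviations in units of \<sigma>.\<close>
  proof (rule that[of p q "1 / sqrt a" "sqrt (a / d)" r])
    show "p \<bullet> p = 1" "q \<bullet> q = 1" "p \<bullet> q = 0"
      using \<open>a > 0\<close> \<open>d > 0\<close> by (simp_all add: p_def q_def ww X1w flip: a_def)
    show "1 / sqrt a > 0" "sqrt (a / d) > 0" "r > 0"
      using \<open>a > 0\<close> \<open>c > 0\<close> \<open>d > 0\<close> by (simp_all add: r_def)
    show "r\<^sup>2 + (rho X)\<^sup>2 = 1"
      using \<open>a > 0\<close> \<open>c > 0\<close> \<open>d > 0\<close>
      by (simp add: r_def rho power_divide d_def add_divide_distrib[symmetric])
    show "coef X M1 1 v = 1 / sqrt a * (p \<bullet> v)" for v
      using sq by (simp add: ols matrix_vector_mult_def[of "inv_gram _"] sum_1 gram1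
          vector_matrix_mult_nth col1 p_def)
    show "coef X M2 2 v = - sqrt (a / d) * (q \<bullet> v)" for v
      using sqrt_nz by (simp add: ols matrix_vector_mult_def[of "inv_gram _"] sum_2 gram
          vector_matrix_mult_nth q_def w_def inner_simps real_sqrt_mult real_sqrt_divide
          field_simps sq flip: X1_def X2_def)
    show "coef X M2 1 v = 1 / sqrt a / r * (r * (p \<bullet> v) - rho X * (q \<bullet> v))" for v
    proof -
      let ?x = "X1 \<bullet> v" and ?y = "X2 \<bullet> v"
      \<comment> \<open>With \<open>A\<close>, \<open>C\<close>, \<open>D\<close> in place of the
        square roots of \<open>a\<close>, \<open>c\<close>, \<open>d\<close>, the identity is plain
        cancellation of fractions.\<close>
      have cancel: "x / (A * A) + e / (A * A * (D * D))
          = C / D * (D / (A * C) * (x / A) + b / (A * C) * (e' / (A * D)))"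
        if "A > 0" "C > 0" "D > 0" "e = b * e'" for A C D x e e' :: real
        using that by (simp add: distrib_left)
      have "coef X M2 1 v = (c * ?x - b * ?y) / d"
        by (simp add: ols matrix_vector_mult_def[of "inv_gram _"] sum_2 gram
            vector_matrix_mult_nth diff_divide_distrib flip: X1_def X2_def)
      \<comment> \<open>Split off the coefficient ?x / a of the small model; the rest is a multiple
        of \<open>w \<bullet> v\<close>.\<close>
      also have "\<dots> = ?x / a + b * (b * ?x - a * ?y) / (a * d)"
        using \<open>a > 0\<close> \<open>d > 0\<close> by (simp add: field_simps) (simp add: d_def power2_eq_square algebra_simps)
      also have "\<dots> = ?x / (sqrt a * sqrt a) + b * (b * ?x - a * ?y) / (sqrt a * sqrt a * (sqrt d * sqrt d))"
        by (simp only: sq)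
      also have "\<dots> = sqrt c / sqrt d * (sqrt d / (sqrt a * sqrt c) * (?x / sqrt a)
          + b / (sqrt a * sqrt c) * ((b * ?x - a * ?y) / (sqrt a * sqrt d)))"
        using sqrt_nz by (intro cancel) simp_all
      finally show ?thesis
        unfolding ar by (simp add: r_def rho p_def q_def w_def real_sqrt_mult real_sqrt_divide inner_simps)
    qed
    show "se X M1 1 s = 1 / sqrt a * s" if "s \<ge> 0" for s
      using that by (simp add: se_def gram1 real_sqrt_mult real_sqrt_divide)
    show "se X M2 2 s = sqrt (a / d) * s" if "s \<ge> 0" for s
      using that by (simp add: se_def gram real_sqrt_mult real_sqrt_divide)
    show "se X M2 1 s = 1 / sqrt a / r * s" if "s \<ge> 0" for s
      using that unfolding ar by (simp add: se_def gram real_sqrt_mult real_sqrt_divide)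
  qed
qed

subsection \<open>Conditioning on an independent variable\<close>

lemma measure_pair_sections:
  assumes "prob_space A" "prob_space B" and E: "E \<in> sets (A \<Otimes>\<^sub>M B)"
  shows "measure (A \<Otimes>\<^sub>M B) E = (\<integral>x. measure B (Pair x -` E) \<partial>A)"
    and "(\<lambda>x. measure B (Pair x -` E)) \<in> borel_measurable A"
proof -
  interpret A: prob_space A by fact
  interpret B: prob_space B by fact
  interpret pair_prob_space A B ..
  show meas: "(\<lambda>x. measure B (Pair x -` E)) \<in> borel_measurable A"
    using B.measurable_emeasure_Pair[OF E] by (simp add: measure_def)
  have "emeasure (A \<Otimes>\<^sub>M B) E = (\<integral>\<^sup>+x. emeasure B (Pair x -` E) \<partial>A)"
    by (rule B.emeasure_pair_measure_alt[OF E])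
  then show "measure (A \<Otimes>\<^sub>M B) E = (\<integral>x. measure B (Pair x -` E) \<partial>A)"
    using meas by (simp add: integral_eq_nn_integral B.emeasure_eq_measure measure_def[of "A \<Otimes>\<^sub>M B" E])
qed

text \<open>Preimages under \<open>f\<close> and \<open>g\<close> stay in the two independent
  families, so the joint law and the product agree on rectangles.\<close>

lemma (in prob_space) indep_rv_distr_pair:
  assumes YZ: "indep_rv M S Y T Z" and fg[measurable]: "f \<in> measurable S S'" "g \<in> measurable T T'"
  shows "distr M (S' \<Otimes>\<^sub>M T') (\<lambda>\<omega>. (f (Y \<omega>), g (Z \<omega>)))
    = distr M S' (\<lambda>\<omega>. f (Y \<omega>)) \<Otimes>\<^sub>M distr M T' (\<lambda>\<omega>. g (Z \<omega>))"
proof (rule pair_measure_eqI[symmetric])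
  have [measurable]: "Y \<in> measurable M S" "Z \<in> measurable M T"
    and ind: "indep_set (sigma_sets (space M) {Y -` A \<inter> space M | A. A \<in> sets S})
       (sigma_sets (space M) {Z -` A \<inter> space M | A. A \<in> sets T})"
    using YZ by (auto simp: indep_rv_def)
  show "sigma_finite_measure (distr M S' (\<lambda>\<omega>. f (Y \<omega>)))" "sigma_finite_measure (distr M T' (\<lambda>\<omega>. g (Z \<omega>)))"
    by (auto intro!: prob_space_imp_sigma_finite prob_space_distr)
  show "sets (distr M S' (\<lambda>\<omega>. f (Y \<omega>)) \<Otimes>\<^sub>M distr M T' (\<lambda>\<omega>. g (Z \<omega>)))
      = sets (distr M (S' \<Otimes>\<^sub>M T') (\<lambda>\<omega>. (f (Y \<omega>), g (Z \<omega>))))"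
    by (simp cong: sets_pair_measure_cong)
  fix A B
  assume "A \<in> sets (distr M S' (\<lambda>\<omega>. f (Y \<omega>)))" "B \<in> sets (distr M T' (\<lambda>\<omega>. g (Z \<omega>)))"
  then have AB[measurable]: "A \<in> sets S'" "B \<in> sets T'"
    by simp_all
  let ?A = "Y -` (f -` A \<inter> space S) \<inter> space M" and ?B = "Z -` (g -` B \<inter> space T) \<inter> space M"
  have "f -` A \<inter> space S \<in> sets S" "g -` B \<inter> space T \<in> sets T"
    by simp_all
  then have "prob (?A \<inter> ?B) = prob ?A * prob ?B"
    by (intro indep_setD[OF ind] sigma_sets.Basic) blast+
  moreover have "?A = (\<lambda>\<omega>. f (Y \<omega>)) -` A \<inter> space M" "?B = (\<lambda>\<omega>. g (Z \<omega>)) -` B \<inter> space M"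
    using measurable_space[of Y M S] measurable_space[of Z M T] by auto
  moreover have "((\<lambda>\<omega>. f (Y \<omega>)) -` A \<inter> space M) \<inter> ((\<lambda>\<omega>. g (Z \<omega>)) -` B \<inter> space M)
      = (\<lambda>\<omega>. (f (Y \<omega>), g (Z \<omega>))) -` (A \<times> B) \<inter> space M"
    by auto
  ultimately show "emeasure (distr M S' (\<lambda>\<omega>. f (Y \<omega>))) A * emeasure (distr M T' (\<lambda>\<omega>. g (Z \<omega>))) B
      = emeasure (distr M (S' \<Otimes>\<^sub>M T') (\<lambda>\<omega>. (f (Y \<omega>), g (Z \<omega>)))) (A \<times> B)"
    by (simp add: emeasure_distr emeasure_eq_measure ennreal_mult')
qed

text \<open>Conditioning on \<open>Y\<close>. Independence enters through the product form
  \<open>D\<close> of the joint law, so the same statement serves the original and the rotated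
  normal pair. Section measures are bounded by 1, hence integrable.\<close>

lemma (in prob_space) prob_eq_expectation_section:
  assumes [measurable]: "Y \<in> measurable M S" "Z \<in> measurable M T"
    and N: "prob_space N" and sets_N: "sets N = sets T"
    and D: "distr M (S \<Otimes>\<^sub>M T) (\<lambda>\<omega>. (Y \<omega>, Z \<omega>)) = distr M S Y \<Otimes>\<^sub>M N"
    and E[measurable]: "E \<in> sets (S \<Otimes>\<^sub>M T)"
  shows "prob {\<omega> \<in> space M. (Y \<omega>, Z \<omega>) \<in> E} = expectation (\<lambda>\<omega>. measure N (Pair (Y \<omega>) -` E))"
    and "integrable M (\<lambda>\<omega>. measure N (Pair (Y \<omega>) -` E))"
proof -
  have E': "E \<in> sets (distr M S Y \<Otimes>\<^sub>M N)"
    using E by (simp add: sets_N cong: sets_pair_measure_cong)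
  have pS: "prob_space (distr M S Y)"
    by (rule prob_space_distr) simp
  note sec = measure_pair_sections[OF pS N E']
  have "prob {\<omega> \<in> space M. (Y \<omega>, Z \<omega>) \<in> E} = measure (distr M (S \<Otimes>\<^sub>M T) (\<lambda>\<omega>. (Y \<omega>, Z \<omega>))) E"
    by (subst measure_distr) (auto intro!: arg_cong[where f=prob])
  also have "\<dots> = (\<integral>x. measure N (Pair x -` E) \<partial>distr M S Y)"
    unfolding D by (rule sec(1))
  also have "\<dots> = expectation (\<lambda>\<omega>. measure N (Pair (Y \<omega>) -` E))"
    using sec(2) by (simp add: integral_distr)
  finally show "prob {\<omega> \<in> space M. (Y \<omega>, Z \<omega>) \<in> E} = expectation (\<lambda>\<omega>. measure N (Pair (Y \<omega>) -` E))" .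
  have meas: "(\<lambda>x. measure N (Pair x -` E)) \<in> borel_measurable S"
    using sec(2) by simp
  interpret N: prob_space N by fact
  show "integrable M (\<lambda>\<omega>. measure N (Pair (Y \<omega>) -` E))"
    by (rule integrable_const_bound[where B=1]) (use measurable_compose[OF _ meas, of Y M] in auto)
qed

subsection \<open>Gaussian measure of boxes and strips\<close>

text \<open>Differences of the distribution function measure half-open intervals; the missing left
  endpoint is a null set.\<close>

lemma measure_std_normal_centered:
  assumes "c \<ge> 0"
  shows "measure std_normal_distribution {x. \<bar>m - x\<bar> \<le> c} = Delta m c"
proof -
  interpret real_distribution std_normal_distribution
    by (rule real_dist_normal_dist)
  let ?N = std_normal_distribution
  have atom: "measure ?N {x} = 0" for x :: real
  proof -
    have "{x} \<in> null_sets lborel"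
      by (rule null_setsI) simp_all
    then have "emeasure ?N {x} = 0"
      by (subst emeasure_density) (simp_all add: nn_integral_null_set)
    then show ?thesis
      by (simp only: measure_def enn2real_0)
  qed
  have "measure ?N {x. \<bar>m - x\<bar> \<le> c} = measure ?N ({m - c<..m + c} \<union> {m - c})"
    using assms by (intro arg_cong[where f="measure ?N"]) auto
  also have "\<dots> = measure ?N {m - c<..m + c}"
    using assms by (subst finite_measure_Union) (auto simp: atom)
  \<comment> \<open>For \<open>c = 0\<close> the half-open interval is empty and
    \<open>Delta m 0 = 0\<close>.\<close>
  also have "\<dots> = Delta m c"
    using assms cdf_diff_eq[of "m - c" "m + c"] by (cases "c = 0") (auto simp: Delta_def)
  finally show ?thesis .
qed

lemma measure_std_normal_box:
  assumes "k \<ge> 0" "c \<ge> 0"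
  shows "measure (std_normal_distribution \<Otimes>\<^sub>M std_normal_distribution)
      {z. \<bar>m - fst z\<bar> \<le> k \<and> \<bar>\<zeta> - snd z\<bar> \<le> c} = Delta m k * Delta \<zeta> c" (is "measure (?N \<Otimes>\<^sub>M ?N) _ = _")
proof -
  interpret N: prob_space ?N
    by (rule prob_space_std_normal)
  have "{z. \<bar>m - fst z\<bar> \<le> k \<and> \<bar>\<zeta> - snd z\<bar> \<le> c} = {x. \<bar>m - x\<bar> \<le> k} \<times> {x. \<bar>\<zeta> - x\<bar> \<le> c}"
    by auto
  moreover have "emeasure (?N \<Otimes>\<^sub>M ?N) ({x. \<bar>m - x\<bar> \<le> k} \<times> {x. \<bar>\<zeta> - x\<bar> \<le> c})
      = emeasure ?N {x. \<bar>m - x\<bar> \<le> k} * emeasure ?N {x. \<bar>\<zeta> - x\<bar> \<le> c}"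
    by (rule N.emeasure_pair_measure_Times) simp_all
  ultimately show ?thesis
    unfolding measure_std_normal_centered[OF assms(1), symmetric]
      measure_std_normal_centered[OF assms(2), symmetric] measure_def
    by (simp only: enn2real_mult)
qed

text \<open>Integrate over the second coordinate first. Dividing by \<open>r > 0\<close> turns each
  nonempty section into the complement of the interval with centre (\<zeta> + \<rho> z) / r and
  radius c / r.\<close>

lemma measure_std_normal_strip:
  assumes "r > 0" "c \<ge> 0"
  shows "measure (std_normal_distribution \<Otimes>\<^sub>M std_normal_distribution)
      {z. \<bar>fst z\<bar> \<le> k \<and> \<bar>\<zeta> + \<rho> * fst z - r * snd z\<bar> > c}
    = (LBINT z:{- k..k}. (1 - Delta ((\<zeta> + \<rho> * z) / r) (c / r)) * std_normal_density z)"
    (is "measure (?N \<Otimes>\<^sub>M ?N) ?E = _")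
proof -
  interpret N: prob_space ?N
    by (rule prob_space_std_normal)
  have E: "?E \<in> sets (?N \<Otimes>\<^sub>M ?N)"
  proof -
    have "{z \<in> space (borel \<Otimes>\<^sub>M borel). \<bar>fst z\<bar> \<le> k \<and> \<bar>\<zeta> + \<rho> * fst z - r * snd z\<bar> > c}
        \<in> sets (borel \<Otimes>\<^sub>M borel)"
      by measurable
    then have "?E \<in> sets (borel \<Otimes>\<^sub>M borel)"
      by (simp add: space_pair_measure)
    then show ?thesis
      by (simp cong: sets_pair_measure_cong)
  qed
  have sec: "measure ?N (Pair z -` ?E)
      = indicator {- k..k} z * (1 - Delta ((\<zeta> + \<rho> * z) / r) (c / r))" for z
  proof (cases "\<bar>z\<bar> \<le> k")
    case True
    have iff: "\<bar>\<zeta> + \<rho> * z - r * w\<bar> > c \<longleftrightarrow> \<not> \<bar>(\<zeta> + \<rho> * z) / r - w\<bar> \<le> c / r" for w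
    proof -
      have "\<zeta> + \<rho> * z - r * w = r * ((\<zeta> + \<rho> * z) / r - w)"
        using assms(1) by (simp add: field_simps)
      then show ?thesis
        using assms(1) by (simp add: abs_mult not_le pos_divide_less_eq mult.commute)
    qed
    have "Pair z -` ?E = space ?N - {w. \<bar>(\<zeta> + \<rho> * z) / r - w\<bar> \<le> c / r}"
      using True by (simp only: set_eq_iff vimage_eq mem_Collect_eq fst_conv snd_conv iff) simp
    moreover have "measure ?N (space ?N - {w. \<bar>(\<zeta> + \<rho> * z) / r - w\<bar> \<le> c / r})
        = 1 - measure ?N {w. \<bar>(\<zeta> + \<rho> * z) / r - w\<bar> \<le> c / r}"
      by (rule N.prob_compl) simp
    moreover have "z \<in> {- k..k}"
      using True by (simp add: abs_le_iff)
    ultimately show ?thesis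
      using assms measure_std_normal_centered[of "c / r" "(\<zeta> + \<rho> * z) / r"]
      by simp
  next
    case False
    then have "Pair z -` ?E = {}" "z \<notin> {- k..k}"
      by auto
    then show ?thesis
      by (simp only: measure_empty) simp
  qed
  \<comment> \<open>Measurability comes for free, since the integrand is the measure of a
    section.\<close>
  have meas: "(\<lambda>z. indicator {- k..k} z * (1 - Delta ((\<zeta> + \<rho> * z) / r) (c / r))) \<in> borel_measurable borel"
    using measure_pair_sections(2)[OF N.prob_space_axioms N.prob_space_axioms E] unfolding sec by simp
  have "measure (?N \<Otimes>\<^sub>M ?N) ?E
      = (\<integral>z. indicator {- k..k} z * (1 - Delta ((\<zeta> + \<rho> * z) / r) (c / r)) \<partial>?N)"
    unfolding measure_pair_sections(1)[OF N.prob_space_axioms N.prob_space_axioms E] sec ..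
  also have "\<dots> = (LBINT z:{- k..k}. (1 - Delta ((\<zeta> + \<rho> * z) / r) (c / r)) * std_normal_density z)"
    using meas by (subst integral_density) (auto simp: set_lebesgue_integral_def mult_ac)
  finally show ?thesis .
qed

subsection \<open>Coverage after model selection\<close>

text \<open>The law \<open>D1\<close> handles the event that the small model is selected, the rotated law \<open>D2\<close> the
  event that the large one is. The guard \<open>0 < S \<omega>\<close> comes from \<open>x / 0 = 0\<close>: a vanishing standard
  error selects the small model.\<close>

lemma (in prob_space) selection_coverage:
  fixes S Z1 Z2 :: "'a \<Rightarrow> real" and \<zeta> :: real
  defines "N2 \<equiv> std_normal_distribution \<Otimes>\<^sub>M std_normal_distribution"
  assumes [measurable]: "S \<in> borel_measurable M" "Z1 \<in> borel_measurable M" "Z2 \<in> borel_measurable M"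
    and S: "\<And>\<omega>. \<omega> \<in> space M \<Longrightarrow> S \<omega> \<ge> 0" "AE \<omega> in M. S \<omega> > 0"
    and KC: "K \<ge> 0" "C \<ge> 0"
    and r: "r > 0" "r\<^sup>2 + \<rho>\<^sup>2 = 1"
    and D1: "distr M (borel \<Otimes>\<^sub>M (borel \<Otimes>\<^sub>M borel)) (\<lambda>\<omega>. (S \<omega>, (Z1 \<omega>, Z2 \<omega>)))
      = distr M borel S \<Otimes>\<^sub>M N2"
    and D2: "distr M (borel \<Otimes>\<^sub>M (borel \<Otimes>\<^sub>M borel))
        (\<lambda>\<omega>. (S \<omega>, (r * Z1 \<omega> - \<rho> * Z2 \<omega>, \<rho> * Z1 \<omega> + r * Z2 \<omega>)))
      = distr M borel S \<Otimes>\<^sub>M N2"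
  defines "G \<equiv> \<lambda>\<omega>. LBINT z:{- (S \<omega> * K)..S \<omega> * K}.
      (1 - Delta ((\<zeta> + \<rho> * z) / r) (S \<omega> * C / r)) * std_normal_density z"
  shows "integrable M (\<lambda>\<omega>. Delta m (S \<omega> * K) * Delta \<zeta> (S \<omega> * C))"
    and "integrable M G"
    and "prob {\<omega> \<in> space M. if 0 < S \<omega> \<and> S \<omega> * C < \<bar>\<zeta> - Z2 \<omega>\<bar>
          then \<bar>r * Z1 \<omega> - \<rho> * Z2 \<omega>\<bar> \<le> S \<omega> * K else \<bar>m - Z1 \<omega>\<bar> \<le> S \<omega> * K}
      = expectation (\<lambda>\<omega>. Delta m (S \<omega> * K) * Delta \<zeta> (S \<omega> * C)) + expectation G"
proof -
  let ?B = "borel \<Otimes>\<^sub>M (borel \<Otimes>\<^sub>M borel) :: (real \<times> real \<times> real) measure"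
  have N2: "prob_space N2"
    unfolding N2_def by (intro prob_space_pair prob_space_std_normal)
  have sets_N2: "sets N2 = sets (borel \<Otimes>\<^sub>M borel)"
    unfolding N2_def by (rule sets_pair_measure_cong) simp_all
  \<comment> \<open>Points are triples of the scale and two normals: \<open>E1\<close> is evaluated
    at the original pair, \<open>E2\<close> at the rotated one.\<close>
  define E1 :: "(real \<times> real \<times> real) set" where
    "E1 = {z. \<bar>m - fst (snd z)\<bar> \<le> fst z * K \<and> \<bar>\<zeta> - snd (snd z)\<bar> \<le> fst z * C}"
  define E2 :: "(real \<times> real \<times> real) set" where
    "E2 = {z. \<bar>fst (snd z)\<bar> \<le> fst z * K \<and> \<bar>\<zeta> + \<rho> * fst (snd z) - r * snd (snd z)\<bar> > fst z * C}"
  have "{z \<in> space ?B. \<bar>m - fst (snd z)\<bar> \<le> fst z * K \<and> \<bar>\<zeta> - snd (snd z)\<bar> \<le> fst z * C} \<in> sets ?B"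
    by measurable
  then have E1: "E1 \<in> sets ?B"
    by (simp add: E1_def space_pair_measure)
  have "{z \<in> space ?B. \<bar>fst (snd z)\<bar> \<le> fst z * K
      \<and> \<bar>\<zeta> + \<rho> * fst (snd z) - r * snd (snd z)\<bar> > fst z * C} \<in> sets ?B"
    by measurable
  then have E2: "E2 \<in> sets ?B"
    by (simp add: E2_def space_pair_measure)
  have sec1: "measure N2 (Pair (S \<omega>) -` E1) = Delta m (S \<omega> * K) * Delta \<zeta> (S \<omega> * C)"
    if "\<omega> \<in> space M" for \<omega>
    using measure_std_normal_box[of "S \<omega> * K" "S \<omega> * C" m \<zeta>] S(1)[OF that] KC
    by (simp add: N2_def E1_def)
  have sec2: "measure N2 (Pair (S \<omega>) -` E2) = G \<omega>" if "\<omega> \<in> space M" for \<omega>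
    using measure_std_normal_strip[of r "S \<omega> * C" "S \<omega> * K" \<zeta> \<rho>] S(1)[OF that] KC r(1)
    by (simp add: N2_def E2_def G_def)
  have Z2_rot: "\<zeta> + \<rho> * (r * z1 - \<rho> * z2) - r * (\<rho> * z1 + r * z2) = \<zeta> - z2" for z1 z2
  proof -
    have "\<zeta> + \<rho> * (r * z1 - \<rho> * z2) - r * (\<rho> * z1 + r * z2) = \<zeta> - (r\<^sup>2 + \<rho>\<^sup>2) * z2"
      by (simp add: algebra_simps power2_eq_square)
    then show ?thesis
      by (simp add: r)
  qed
  have m1: "(\<lambda>\<omega>. (Z1 \<omega>, Z2 \<omega>)) \<in> measurable M (borel \<Otimes>\<^sub>M borel)"
    and m2: "(\<lambda>\<omega>. (r * Z1 \<omega> - \<rho> * Z2 \<omega>, \<rho> * Z1 \<omega> + r * Z2 \<omega>)) \<in> measurable M (borel \<Otimes>\<^sub>M borel)"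
    by measurable
  note P1 = prob_eq_expectation_section[OF assms(2) m1 N2 sets_N2 D1 E1]
  note P2 = prob_eq_expectation_section[OF assms(2) m2 N2 sets_N2 D2 E2]
  show i1: "integrable M (\<lambda>\<omega>. Delta m (S \<omega> * K) * Delta \<zeta> (S \<omega> * C))"
    using P1(2) sec1 by (simp cong: Bochner_Integration.integrable_cong)
  show i2: "integrable M G"
    using P2(2) sec2 by (simp cong: Bochner_Integration.integrable_cong)
  define A where "A = {\<omega> \<in> space M. \<bar>m - Z1 \<omega>\<bar> \<le> S \<omega> * K \<and> \<bar>\<zeta> - Z2 \<omega>\<bar> \<le> S \<omega> * C}"
  define B where "B = {\<omega> \<in> space M. \<bar>r * Z1 \<omega> - \<rho> * Z2 \<omega>\<bar> \<le> S \<omega> * K \<and> \<bar>\<zeta> - Z2 \<omega>\<bar> > S \<omega> * C}"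
  have A: "prob A = expectation (\<lambda>\<omega>. Delta m (S \<omega> * K) * Delta \<zeta> (S \<omega> * C))"
    using P1(1) sec1 by (simp add: E1_def A_def cong: Bochner_Integration.integral_cong)
  have B: "prob B = expectation G"
    using P2(1) sec2 by (simp add: E2_def B_def Z2_rot cong: Bochner_Integration.integral_cong)
  have AB_meas[measurable]: "A \<in> events" "B \<in> events"
    unfolding A_def B_def by measurable
  have "prob {\<omega> \<in> space M. if 0 < S \<omega> \<and> S \<omega> * C < \<bar>\<zeta> - Z2 \<omega>\<bar>
        then \<bar>r * Z1 \<omega> - \<rho> * Z2 \<omega>\<bar> \<le> S \<omega> * K else \<bar>m - Z1 \<omega>\<bar> \<le> S \<omega> * K} = prob (A \<union> B)"
  \<comment> \<open>The two events agree only where \<open>S \<omega> > 0\<close>: at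
    \<open>S \<omega> = 0\<close> the guard forces the second branch, while the point may lie in
    \<open>B\<close>.\<close>
  proof (rule finite_measure_eq_AE)
    show "AE \<omega> in M. (\<omega> \<in> {\<omega> \<in> space M. if 0 < S \<omega> \<and> S \<omega> * C < \<bar>\<zeta> - Z2 \<omega>\<bar>
        then \<bar>r * Z1 \<omega> - \<rho> * Z2 \<omega>\<bar> \<le> S \<omega> * K else \<bar>m - Z1 \<omega>\<bar> \<le> S \<omega> * K}) = (\<omega> \<in> A \<union> B)"
      using S(2) by eventually_elim (auto simp: A_def B_def)
    show "{\<omega> \<in> space M. if 0 < S \<omega> \<and> S \<omega> * C < \<bar>\<zeta> - Z2 \<omega>\<bar>
        then \<bar>r * Z1 \<omega> - \<rho> * Z2 \<omega>\<bar> \<le> S \<omega> * K else \<bar>m - Z1 \<omega>\<bar> \<le> S \<omega> * K} \<in> events"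
      unfolding if_bool_eq_disj by measurable
    show "A \<union> B \<in> events"
      by (rule sets.Un) (fact AB_meas)+
  qed
  also have "\<dots> = prob A + prob B"
    by (rule finite_measure_Union) (auto simp: A_def B_def)
  finally show "prob {\<omega> \<in> space M. if 0 < S \<omega> \<and> S \<omega> * C < \<bar>\<zeta> - Z2 \<omega>\<bar>
        then \<bar>r * Z1 \<omega> - \<rho> * Z2 \<omega>\<bar> \<le> S \<omega> * K else \<bar>m - Z1 \<omega>\<bar> \<le> S \<omega> * K}
      = expectation (\<lambda>\<omega>. Delta m (S \<omega> * K) * Delta \<zeta> (S \<omega> * C)) + expectation G"
    using A B by simp
qed

section \<open>Standard deviation of a coefficient and law of the scale
  \<open>s / \<sigma>\<close>\<close>

lemma (in prob_space) SD_affine_std_normal: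
  assumes "distributed M lborel Z std_normal_density" "\<tau> > 0"
    and Y: "\<And>\<omega>. \<omega> \<in> space M \<Longrightarrow> Y \<omega> = b - \<tau> * Z \<omega>"
  shows "SD M Y = \<tau>"
proof -
  have D: "distributed M lborel (\<lambda>\<omega>. b + - \<tau> * Z \<omega>) (normal_density b \<tau>)"
    using normal_density_affine[OF assms(1), of "- \<tau>" b] assms(2) by simp
  have "variance (\<lambda>\<omega>. b + - \<tau> * Z \<omega>) = \<tau>\<^sup>2"
    using normal_distributed_variance[OF assms(2) D] .
  then have "variance Y = \<tau>\<^sup>2"
    using Y by (simp cong: Bochner_Integration.integral_cong)
  then show ?thesis
    using assms(2) by (simp add: SD_def)
qed

text \<open>The assumption concerns the square of \<open>s\<close>. Since \<open>s\<close> is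
  nonnegative, pushing both laws forward under the square root recovers \<open>s\<close>, and
  \<sigma> cancels.\<close>

lemma distr_variance_estimator:
  assumes "\<sigma> > 0" and [measurable]: "s \<in> borel_measurable P"
    and nonneg: "\<forall>\<omega>\<in>space P. s \<omega> \<ge> 0" and ve: "variance_estimator P r \<sigma> s"
  shows "case r of
      enat k \<Rightarrow> distr P borel (\<lambda>\<omega>. s \<omega> / \<sigma>) = distr (chi_square k) borel (\<lambda>x. sqrt (x / real k))
    | \<infinity> \<Rightarrow> (\<forall>\<omega>\<in>space P. s \<omega> / \<sigma> = 1)"
proof (cases r)
  case (enat k)
  then have D: "distr P borel (\<lambda>\<omega>. (s \<omega>)\<^sup>2) = distr (chi_square k) borel (\<lambda>x. \<sigma>\<^sup>2 * x / real k)"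
    using ve by (simp add: variance_estimator_def)
  have [measurable]: "f \<in> borel_measurable (chi_square k)" if "f \<in> borel_measurable borel" for f :: "real \<Rightarrow> real"
    using that by (simp add: chi_square_def)
  have "distr P borel (\<lambda>\<omega>. s \<omega> / \<sigma>) = distr P borel (\<lambda>\<omega>. sqrt ((s \<omega>)\<^sup>2) / \<sigma>)"
    using nonneg by (intro distr_cong) auto
  also have "\<dots> = distr (distr P borel (\<lambda>\<omega>. (s \<omega>)\<^sup>2)) borel (\<lambda>x. sqrt x / \<sigma>)"
    by (simp add: distr_distr comp_def)
  also have "\<dots> = distr (chi_square k) borel (\<lambda>x. sqrt (\<sigma>\<^sup>2 * x / real k) / \<sigma>)"
    unfolding D by (simp add: distr_distr comp_def)
  also have "(\<lambda>x. sqrt (\<sigma>\<^sup>2 * x / real k) / \<sigma>) = (\<lambda>x. sqrt (x / real k))"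
    using assms(1) by (simp add: real_sqrt_mult real_sqrt_divide)
  finally show ?thesis
    by (simp add: enat)
next
  case infinity
  have "s \<omega> / \<sigma> = 1" if "\<omega> \<in> space P" for \<omega>
  proof -
    have "(s \<omega>)\<^sup>2 = \<sigma>\<^sup>2"
      using that ve infinity by (simp add: variance_estimator_def)
    then have "s \<omega> = \<sigma>"
      using that assms(1) nonneg by (simp add: power2_eq_iff_nonneg)
    then show ?thesis
      using assms(1) by simp
  qed
  then have "\<forall>\<omega>\<in>space P. s \<omega> / \<sigma> = 1"
    by blast
  then show ?thesis
    by (simp only: infinity enat.case)
qed

text \<open>The chi-square density vanishes for x \<le> 0, so a zero standard error has probability
  zero.\<close>

lemma AE_variance_estimator_pos:
  assumes "\<sigma> > 0" and [measurable]: "s \<in> borel_measurable P"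
    and nonneg: "\<forall>\<omega>\<in>space P. s \<omega> \<ge> 0" and ve: "variance_estimator P r \<sigma> s"
  shows "AE \<omega> in P. s \<omega> / \<sigma> > 0"
proof (cases r)
  case (enat k)
  then have "k \<ge> 1" and D: "distr P borel (\<lambda>\<omega>. s \<omega> / \<sigma>) = distr (chi_square k) borel (\<lambda>x. sqrt (x / real k))"
    using ve distr_variance_estimator[OF assms] by (simp_all add: variance_estimator_def)
  have m: "chi_square_density k \<in> borel_measurable borel"
    unfolding chi_square_density_def[abs_def] by measurable
  have "AE x in chi_square k. sqrt (x / real k) > 0"
    unfolding chi_square_def using m \<open>k \<ge> 1\<close>
    by (subst AE_density) (auto intro!: AE_I2 simp: chi_square_density_def split: if_splits)
  then have "AE x in distr (chi_square k) borel (\<lambda>x. sqrt (x / real k)). x > 0"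
    by (subst AE_distr_iff) (simp_all add: chi_square_def)
  then have "AE x in distr P borel (\<lambda>\<omega>. s \<omega> / \<sigma>). x > 0"
    by (simp only: D)
  then show ?thesis
    by (subst (asm) AE_distr_iff) simp_all
next
  case infinity
  then show ?thesis
    using distr_variance_estimator[OF assms] by (auto intro!: AE_I2)
qed

text \<open>The expectations are over \<open>P\<close>, but their integrands depend on \<omega> only
  through \<open>s \<omega> / \<sigma>\<close>; the third conjunct identifies its law.\<close>

theorem proposition3p1:
  fixes P :: "'a measure" and X :: "real^2^'n" and \<mu> :: "real^'n" and \<sigma> C K :: real
    and r :: enat and y u :: "'a \<Rightarrow> real^'n" and s :: "'a \<Rightarrow> real"
  defines "Mhat \<equiv> \<lambda>\<omega>. selected X C (y \<omega>) (s \<omega>)"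
    and "\<rho> \<equiv> rho X"
    and "\<zeta> \<equiv> coef X M2 2 \<mu> / SD P (\<lambda>\<omega>. coef X M2 2 (y \<omega>))"
  assumes "prob_space P"
    and "\<sigma> > 0" and "C > 0" and "K > 0"
    and "rank X = 2"
    and "distributed P lborel u (mvnormal_density 0 (\<sigma>\<^sup>2 *\<^sub>R mat 1))"
    and "\<forall>\<omega>\<in>space P. y \<omega> = \<mu> + u \<omega>"
    and "s \<in> borel_measurable P"
    and "\<forall>\<omega>\<in>space P. s \<omega> \<ge> 0"
    and "indep_rv P borel (\<lambda>\<omega>. (s \<omega>)\<^sup>2)
           borel (\<lambda>\<omega>. (ols (X_M1 X) (y \<omega>), ols X (y \<omega>)))"
    and "variance_estimator P r \<sigma> s"
  shows "\<P>(\<omega> in P. coef X (Mhat \<omega>) 1 \<mu>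
             \<in> pm_interval (coef X (Mhat \<omega>) 1 (y \<omega>)) (K * se X (Mhat \<omega>) 1 (s \<omega>)))
         = prob_space.expectation P (\<lambda>\<omega>.
             Delta 0 (s \<omega> / \<sigma> * K) * Delta \<zeta> (s \<omega> / \<sigma> * C)
             + (LBINT z:{- (s \<omega> / \<sigma> * K) .. s \<omega> / \<sigma> * K}.
                  (1 - Delta ((\<zeta> + \<rho> * z) / sqrt (1 - \<rho>\<^sup>2)) (s \<omega> / \<sigma> * C / sqrt (1 - \<rho>\<^sup>2)))
                  * std_normal_density z))
       \<and> \<P>(\<omega> in P. coef X M2 1 \<mu>
             \<in> pm_interval (coef X (Mhat \<omega>) 1 (y \<omega>)) (K * se X (Mhat \<omega>) 1 (s \<omega>)))
         = \<P>(\<omega> in P. coef X (Mhat \<omega>) 1 \<mu>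
             \<in> pm_interval (coef X (Mhat \<omega>) 1 (y \<omega>)) (K * se X (Mhat \<omega>) 1 (s \<omega>)))
           + prob_space.expectation P (\<lambda>\<omega>.
               (Delta (\<rho> * \<zeta> / sqrt (1 - \<rho>\<^sup>2)) (s \<omega> / \<sigma> * K) - Delta 0 (s \<omega> / \<sigma> * K))
               * Delta \<zeta> (s \<omega> / \<sigma> * C))
       \<and> (case r of
            enat k \<Rightarrow> distr P borel (\<lambda>\<omega>. s \<omega> / \<sigma>)
                      = distr (chi_square k) borel (\<lambda>x. sqrt (x / real k))
          | \<infinity> \<Rightarrow> (\<forall>\<omega>\<in>space P. s \<omega> / \<sigma> = 1))"
proof -
  \<comment> \<open>Keeps \<open>coef\<close> folded, so that the formulas \<open>coef1\<close> to
    \<open>coef3\<close> apply.\<close>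
  note [simp del] = coef.simps
  note \<sigma> = \<open>\<sigma> > 0\<close> and K = \<open>K > 0\<close> and C = \<open>C > 0\<close>
  note u_normal = \<open>distributed P lborel u _\<close>
  note y_eq = \<open>\<forall>\<omega>\<in>space P. y \<omega> = \<mu> + u \<omega>\<close>[rule_format]
  note s_nonneg = \<open>\<forall>\<omega>\<in>space P. s \<omega> \<ge> 0\<close>
  note [measurable] = \<open>s \<in> borel_measurable P\<close>
  interpret prob_space P by fact
  obtain p q :: "real^'n" and \<alpha> \<tau> r' :: real where
    pq: "p \<bullet> p = 1" "q \<bullet> q = 1" "p \<bullet> q = 0" and pos: "\<alpha> > 0" "\<tau> > 0" "r' > 0"
    and r'\<rho>: "r'\<^sup>2 + \<rho>\<^sup>2 = 1"
    and coef1: "\<And>v. coef X M1 1 v = \<alpha> * (p \<bullet> v)"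
    and coef2: "\<And>v. coef X M2 2 v = - \<tau> * (q \<bullet> v)"
    and coef3: "\<And>v. coef X M2 1 v = \<alpha> / r' * (r' * (p \<bullet> v) - \<rho> * (q \<bullet> v))"
    and se: "\<And>s. s \<ge> 0 \<Longrightarrow> se X M1 1 s = \<alpha> * s" "\<And>s. s \<ge> 0 \<Longrightarrow> se X M2 2 s = \<tau> * s"
      "\<And>s. s \<ge> 0 \<Longrightarrow> se X M2 1 s = \<alpha> / r' * s"
    using orthonormal_coefficients[OF \<open>rank X = 2\<close>] unfolding \<rho>_def by metis
  have qp: "q \<bullet> p = 0"
    using pq by (simp add: inner_commute)
  have r'_eq: "sqrt (1 - \<rho>\<^sup>2) = r'"
    using r'\<rho> pos by (intro real_sqrt_unique) auto
  define S where "S \<omega> = s \<omega> / \<sigma>" for \<omega>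
  define Z1 where "Z1 \<omega> = p \<bullet> u \<omega> / \<sigma>" for \<omega>
  define Z2 where "Z2 \<omega> = q \<bullet> u \<omega> / \<sigma>" for \<omega>
  have [measurable]: "u \<in> borel_measurable P"
    using distributed_measurable[OF u_normal] by simp
  have [measurable]: "S \<in> borel_measurable P" "Z1 \<in> borel_measurable P" "Z2 \<in> borel_measurable P"
    unfolding S_def Z1_def Z2_def by measurable
  let ?N = "std_normal_distribution"
  have N12: "distr P (borel \<Otimes>\<^sub>M borel) (\<lambda>\<omega>. (Z1 \<omega>, Z2 \<omega>)) = ?N \<Otimes>\<^sub>M ?N"
    using distr_orthonormal_normal[OF \<sigma> u_normal pq] by (simp add: Z1_def Z2_def)
  \<comment> \<open>The swapped order makes \<open>Z2\<close> a first marginal, from which its law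
    is read off below.\<close>
  have N21: "distr P (borel \<Otimes>\<^sub>M borel) (\<lambda>\<omega>. (Z2 \<omega>, Z1 \<omega>)) = ?N \<Otimes>\<^sub>M ?N"
    using distr_orthonormal_normal[OF \<sigma> u_normal pq(2) pq(1) qp] by (simp add: Z1_def Z2_def)
  have rot: "distr P (borel \<Otimes>\<^sub>M borel) (\<lambda>\<omega>. (r' * Z1 \<omega> - \<rho> * Z2 \<omega>, \<rho> * Z1 \<omega> + r' * Z2 \<omega>)) = ?N \<Otimes>\<^sub>M ?N"
  proof -
    \<comment> \<open>Rotating the directions by the angle with cosine r' and sine \<rho> keeps them
      orthonormal, so the same result applies.\<close>
    have "(r' *\<^sub>R p - \<rho> *\<^sub>R q) \<bullet> (r' *\<^sub>R p - \<rho> *\<^sub>R q) = 1"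
      "(\<rho> *\<^sub>R p + r' *\<^sub>R q) \<bullet> (\<rho> *\<^sub>R p + r' *\<^sub>R q) = 1"
      "(r' *\<^sub>R p - \<rho> *\<^sub>R q) \<bullet> (\<rho> *\<^sub>R p + r' *\<^sub>R q) = 0"
      using r'\<rho> by (simp_all add: inner_simps pq qp power2_eq_square algebra_simps)
    from distr_orthonormal_normal[OF \<sigma> u_normal this] show ?thesis
      by (simp add: Z1_def Z2_def inner_simps add_divide_distrib diff_divide_distrib)
  qed

  have "SD P (\<lambda>\<omega>. coef X M2 2 (y \<omega>)) = \<tau> * \<sigma>"
  proof (rule SD_affine_std_normal)
    have "distr P lborel Z2 = distr P borel Z2"
      by (rule distr_cong) simp_all
    also have "\<dots> = distr (distr P (borel \<Otimes>\<^sub>M borel) (\<lambda>\<omega>. (Z2 \<omega>, Z1 \<omega>))) borel fst"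
      by (simp add: distr_distr comp_def)
    also have "\<dots> = distr (?N \<Otimes>\<^sub>M ?N) ?N fst"
      unfolding N21 by (rule distr_cong) simp_all
    also have "\<dots> = ?N"
      by (rule prob_space.distr_pair_fst[OF prob_space_std_normal])
    finally show "distributed P lborel Z2 std_normal_density"
      by (simp add: distributed_def)
    show "\<tau> * \<sigma> > 0"
      using pos \<sigma> by simp
    show "coef X M2 2 (y \<omega>) = - \<tau> * (q \<bullet> \<mu>) - \<tau> * \<sigma> * Z2 \<omega>" if "\<omega> \<in> space P" for \<omega>
      using \<sigma> by (simp add: coef2 y_eq[OF that] Z2_def inner_simps algebra_simps)
  qed
  then have \<zeta>_eq: "q \<bullet> \<mu> = - \<sigma> * \<zeta>"
    using pos \<sigma> by (simp add: \<zeta>_def coef2)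

  \<comment> \<open>Stated for a general \<open>h\<close>, because both the identity and the
    rotation are needed.\<close>
  have indep: "distr P (borel \<Otimes>\<^sub>M (borel \<Otimes>\<^sub>M borel)) (\<lambda>\<omega>. (S \<omega>, h (Z1 \<omega>, Z2 \<omega>)))
      = distr P borel S \<Otimes>\<^sub>M distr P (borel \<Otimes>\<^sub>M borel) (\<lambda>\<omega>. h (Z1 \<omega>, Z2 \<omega>))"
    if [measurable]: "h \<in> measurable (borel \<Otimes>\<^sub>M borel) (borel \<Otimes>\<^sub>M borel)" for h :: "real \<times> real \<Rightarrow> real \<times> real"
  proof -
    \<comment> \<open>The assumed independence is between the squared scale and the estimators:
      \<open>f\<close> recovers \<open>S\<close>, and \<open>g0\<close> inverts the coefficient
      formulas to recover \<open>Z1\<close> from the small and \<open>Z2\<close> from the large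
      model.\<close>
    define f where "f x = sqrt x / \<sigma>" for x
    define g0 where "g0 w = ((fst w $ 1 / \<alpha> - p \<bullet> \<mu>) / \<sigma>, (- (snd w $ 2) / \<tau> - q \<bullet> \<mu>) / \<sigma>)"
      for w :: "(real^1) \<times> (real^2)"
    have [measurable]: "f \<in> borel_measurable borel"
      unfolding f_def by measurable
    have "g0 \<in> borel_measurable borel"
      unfolding g0_def using \<sigma> pos
      by (intro borel_measurable_continuous_onI continuous_intros) auto
    then have [measurable]: "g0 \<in> measurable borel (borel \<Otimes>\<^sub>M borel)"
      by (simp add: borel_prod)
    have f: "f ((s \<omega>)\<^sup>2) = S \<omega>" if "\<omega> \<in> space P" for \<omega>
      using s_nonneg that by (simp add: f_def S_def)
    have g: "g0 (ols (X_M1 X) (y \<omega>), ols X (y \<omega>)) = (Z1 \<omega>, Z2 \<omega>)" if "\<omega> \<in> space P" for \<omega>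
      using coef1[of "y \<omega>"] coef2[of "y \<omega>"] pos
      by (simp add: g0_def coef.simps Z1_def Z2_def y_eq[OF that] inner_simps)
    have "(\<lambda>w. h (g0 w)) \<in> measurable borel (borel \<Otimes>\<^sub>M borel)"
      by measurable
    note pair = indep_rv_distr_pair[OF \<open>indep_rv P _ _ _ _\<close> \<open>f \<in> borel_measurable borel\<close> this]
    have "distr P (borel \<Otimes>\<^sub>M (borel \<Otimes>\<^sub>M borel)) (\<lambda>\<omega>. (S \<omega>, h (Z1 \<omega>, Z2 \<omega>)))
        = distr P (borel \<Otimes>\<^sub>M (borel \<Otimes>\<^sub>M borel))
            (\<lambda>\<omega>. (f ((s \<omega>)\<^sup>2), h (g0 (ols (X_M1 X) (y \<omega>), ols X (y \<omega>)))))"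
      by (rule distr_cong) (simp_all add: f g)
    moreover have "distr P borel (\<lambda>\<omega>. f ((s \<omega>)\<^sup>2)) = distr P borel S"
      by (rule distr_cong) (simp_all add: f)
    moreover have "distr P (borel \<Otimes>\<^sub>M borel) (\<lambda>\<omega>. h (g0 (ols (X_M1 X) (y \<omega>), ols X (y \<omega>))))
        = distr P (borel \<Otimes>\<^sub>M borel) (\<lambda>\<omega>. h (Z1 \<omega>, Z2 \<omega>))"
      by (rule distr_cong) (simp_all add: g)
    ultimately show ?thesis
      using pair by simp
  qed
  have D1: "distr P (borel \<Otimes>\<^sub>M (borel \<Otimes>\<^sub>M borel)) (\<lambda>\<omega>. (S \<omega>, (Z1 \<omega>, Z2 \<omega>)))
      = distr P borel S \<Otimes>\<^sub>M (?N \<Otimes>\<^sub>M ?N)"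
    using indep[of "\<lambda>z. z"] by (simp add: N12)
  have D2: "distr P (borel \<Otimes>\<^sub>M (borel \<Otimes>\<^sub>M borel))
      (\<lambda>\<omega>. (S \<omega>, (r' * Z1 \<omega> - \<rho> * Z2 \<omega>, \<rho> * Z1 \<omega> + r' * Z2 \<omega>)))
      = distr P borel S \<Otimes>\<^sub>M (?N \<Otimes>\<^sub>M ?N)"
    using indep[of "\<lambda>z. (r' * fst z - \<rho> * snd z, \<rho> * fst z + r' * snd z)"] by (simp add: rot)

  have S_nonneg: "S \<omega> \<ge> 0" if "\<omega> \<in> space P" for \<omega>
    using s_nonneg that \<sigma> by (simp add: S_def)
  have S_pos: "AE \<omega> in P. S \<omega> > 0"
    using AE_variance_estimator_pos[OF \<sigma> \<open>s \<in> _\<close> s_nonneg \<open>variance_estimator P r \<sigma> s\<close>]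
    by (simp add: S_def)
  \<comment> \<open>The shift \<open>m\<close> stays schematic: 0 serves the target of the selected
    model, and \<rho> \<zeta> / r' the fixed target of the large one.\<close>
  note cover = selection_coverage[where \<zeta> = \<zeta>, OF _ _ _ S_nonneg S_pos
      less_imp_le[OF K] less_imp_le[OF C] pos(3) r'\<rho> D1 D2, simplified]

  \<comment> \<open>Selection and coverage in terms of \<open>S\<close>, \<open>Z1\<close> and
    \<open>Z2\<close>\<close>
  have Mhat: "Mhat \<omega> = (if 0 < S \<omega> \<and> S \<omega> * C < \<bar>\<zeta> - Z2 \<omega>\<bar> then M2 else M1)"
    if "\<omega> \<in> space P" for \<omega>
  proof -
    have "coef X M2 2 (y \<omega>) = \<tau> * \<sigma> * (\<zeta> - Z2 \<omega>)"
      using \<sigma> by (simp add: coef2 y_eq[OF that] Z2_def inner_simps \<zeta>_eq algebra_simps)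
    moreover have "se X M2 2 (s \<omega>) = \<tau> * \<sigma> * S \<omega>"
      using s_nonneg that \<sigma> by (simp add: se S_def)
    ultimately have "\<bar>coef X M2 2 (y \<omega>)\<bar> / se X M2 2 (s \<omega>) = \<bar>\<zeta> - Z2 \<omega>\<bar> / S \<omega>"
      using pos \<sigma> by (simp add: abs_mult)
    \<comment> \<open>At \<open>S \<omega> = 0\<close> the quotient is 0 by convention, which does
      not exceed \<open>C > 0\<close>.\<close>
    moreover have "C < \<bar>\<zeta> - Z2 \<omega>\<bar> / S \<omega> \<longleftrightarrow> 0 < S \<omega> \<and> S \<omega> * C < \<bar>\<zeta> - Z2 \<omega>\<bar>"
      using S_nonneg[OF that] C by (cases "S \<omega> = 0") (auto simp: pos_less_divide_eq mult.commute)
    ultimately show ?thesis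
      by (simp add: Mhat_def selected_def)
  qed
  \<comment> \<open>Estimation error and standard error share the positive factor \<open>c\<close>,
    which cancels.\<close>
  have scaled: "x \<in> pm_interval x' (K * h) \<longleftrightarrow> \<bar>z\<bar> \<le> t * K"
    if "x' - x = c * z" "h = c * t" "c > 0" for x x' h z t c :: real
  proof -
    have "x \<in> pm_interval x' (K * h) \<longleftrightarrow> \<bar>x' - x\<bar> \<le> K * h"
      by (auto simp: pm_interval_def abs_le_iff)
    also have "\<dots> \<longleftrightarrow> c * \<bar>z\<bar> \<le> c * (t * K)"
      using that by (simp add: abs_mult mult_ac)
    finally show ?thesis
      using that by simp
  qed
  \<comment> \<open>\<open>0 - Z1 \<omega>\<close> is the instance \<open>m = 0\<close> of the
    coverage event.\<close>
  have cov1: "coef X M1 1 \<mu> \<in> pm_interval (coef X M1 1 (y \<omega>)) (K * se X M1 1 (s \<omega>))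
      \<longleftrightarrow> \<bar>0 - Z1 \<omega>\<bar> \<le> S \<omega> * K" if "\<omega> \<in> space P" for \<omega>
  proof -
    have "coef X M1 1 (y \<omega>) - coef X M1 1 \<mu> = \<alpha> * \<sigma> * Z1 \<omega>" "se X M1 1 (s \<omega>) = \<alpha> * \<sigma> * S \<omega>"
      using \<sigma> s_nonneg that by (simp_all add: coef1 se y_eq Z1_def S_def inner_simps algebra_simps)
    from scaled[OF this] show ?thesis
      using \<sigma> pos by simp
  qed
  have cov2: "coef X M2 1 \<mu> \<in> pm_interval (coef X M2 1 (y \<omega>)) (K * se X M2 1 (s \<omega>))
      \<longleftrightarrow> \<bar>r' * Z1 \<omega> - \<rho> * Z2 \<omega>\<bar> \<le> S \<omega> * K" if "\<omega> \<in> space P" for \<omega>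
  proof -
    have "coef X M2 1 (y \<omega>) - coef X M2 1 \<mu> = \<alpha> / r' * \<sigma> * (r' * Z1 \<omega> - \<rho> * Z2 \<omega>)"
      using \<sigma> pos by (simp add: coef3 y_eq[OF that] Z1_def Z2_def inner_simps field_simps)
    moreover have "se X M2 1 (s \<omega>) = \<alpha> / r' * \<sigma> * S \<omega>"
      using \<sigma> s_nonneg that by (simp add: se S_def)
    ultimately show ?thesis
      by (rule scaled) (use \<sigma> pos in simp)
  qed
  have cov3: "coef X M2 1 \<mu> \<in> pm_interval (coef X M1 1 (y \<omega>)) (K * se X M1 1 (s \<omega>))
      \<longleftrightarrow> \<bar>\<rho> * \<zeta> / r' - Z1 \<omega>\<bar> \<le> S \<omega> * K" if "\<omega> \<in> space P" for \<omega>
  proof -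
    \<comment> \<open>The shift \<rho> \<zeta> / r' is the omitted-variable bias of the small model
      in units of \<alpha> \<sigma>.\<close>
    have "coef X M1 1 (y \<omega>) - coef X M2 1 \<mu> = \<alpha> * \<sigma> * (Z1 \<omega> - \<rho> * \<zeta> / r')"
      using \<sigma> pos by (simp add: coef1 coef3 y_eq[OF that] Z1_def inner_simps \<zeta>_eq field_simps)
    moreover have "se X M1 1 (s \<omega>) = \<alpha> * \<sigma> * S \<omega>"
      using \<sigma> s_nonneg that by (simp add: se S_def)
    ultimately show ?thesis
      using \<sigma> pos scaled[of _ _ "\<alpha> * \<sigma>" "Z1 \<omega> - \<rho> * \<zeta> / r'"] by (simp add: abs_minus_commute)
  qed

  let ?G = "\<lambda>\<omega>. LBINT z:{- (S \<omega> * K)..S \<omega> * K}.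
      (1 - Delta ((\<zeta> + \<rho> * z) / r') (S \<omega> * C / r')) * std_normal_density z"
  let ?D = "\<lambda>m \<omega>. Delta m (S \<omega> * K) * Delta \<zeta> (S \<omega> * C)"
  have P1: "\<P>(\<omega> in P. coef X (Mhat \<omega>) 1 \<mu>
      \<in> pm_interval (coef X (Mhat \<omega>) 1 (y \<omega>)) (K * se X (Mhat \<omega>) 1 (s \<omega>)))
      = expectation (?D 0) + expectation ?G"
    using cover(3)[of 0]
    by (rule trans[rotated]) (auto intro!: arg_cong[where f=prob] simp: Mhat cov1 cov2 split: if_splits)
  have P2: "\<P>(\<omega> in P. coef X M2 1 \<mu>
      \<in> pm_interval (coef X (Mhat \<omega>) 1 (y \<omega>)) (K * se X (Mhat \<omega>) 1 (s \<omega>)))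
      = expectation (?D (\<rho> * \<zeta> / r')) + expectation ?G"
    using cover(3)[of "\<rho> * \<zeta> / r'"]
    by (rule trans[rotated]) (auto intro!: arg_cong[where f=prob] simp: Mhat cov2 cov3 split: if_splits)
  have "expectation (?D 0) + expectation ?G = expectation (\<lambda>\<omega>. ?D 0 \<omega> + ?G \<omega>)"
    using cover(1,2) by (simp add: Bochner_Integration.integral_add)
  \<comment> \<open>The two coverage events differ only when the small model is selected, so the
    integral term cancels in the difference.\<close>
  moreover have "expectation (?D (\<rho> * \<zeta> / r')) - expectation (?D 0)
      = expectation (\<lambda>\<omega>. (Delta (\<rho> * \<zeta> / r') (S \<omega> * K) - Delta 0 (S \<omega> * K)) * Delta \<zeta> (S \<omega> * C))"
    using cover(1) by (simp add: left_diff_distrib Bochner_Integration.integral_diff)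
  ultimately show ?thesis
    using P1 P2 distr_variance_estimator[OF \<sigma> \<open>s \<in> _\<close> s_nonneg \<open>variance_estimator P r \<sigma> s\<close>]
    unfolding r'_eq S_def by linarith
qed

end
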